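(* Let $\lambda,\mu\ge0$ and $\rho\in(0,1)$ be constants with $F(\lambda,\mu,\rho,1)<1-\epsilon$ for some constant $\epsilon>0$. Let $\pi=\pi_*^{\otimes n}$, where $\pi_*$ is the law of a pair $(\mathbb X,\mathbb Y)$ of real random variables such that (1) $\mathbb E[\mathbb X]=\mathbb E[\mathbb Y]=0$, $\mathbb E[\mathbb X^2]=\mathbb E[\mathbb Y^2]=1$, $\mathbb E[\mathbb X\mathbb Y]=\rho$; (2) $\mathbb X$ and $\mathbb Y$ are $C'$-subgaussian for some constant $C'$; (3) $\mathbb E[\mathbb X^a\mathbb Y^b]^2\ge\mathbb E[\mathbb X^a]^2\,\mathbb E[\mathbb Y^b]^2$ for all $a,b\in\mathbb N$. Then $\chi^2_{\le D}(\widehat{\mathbb P};\widehat{\mathbb Q})=O_{\lambda,\mu,\rho}(1)$ for all $D=D_n=n^{o(1)}$. In particular, no (sequence of) degree-$D$ polynomial(s) can strongly separate $\widehat{\mathbb P}$ and $\widehat{\mathbb Q}$ when $D=n^{o(1)}$.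
   Context: $F(\lambda,\mu,\rho,\gamma)=\max\Big\{\frac{\lambda^2}{\gamma},\frac{\mu^2}{\gamma},\frac{\lambda^2\rho^2}{\gamma-\lambda^2+\lambda^2\rho^2}+\frac{\mu^2\rho^2}{\gamma-\mu^2+\mu^2\rho^2}\Big\}$. **Model.** $(x,y)\sim\pi$ means that $(x_i,y_i)$, $1\le i\le n$, are i.i.d. from $\pi_*$, with $x,y\in\mathbb R^n$. $\widehat{\mathbb P}$ is the law of $(\widehat{\boldsymbol X},\widehat{\boldsymbol Y})$ where $\widehat{\boldsymbol X}=\frac{\lambda}{\sqrt{2n}}xx^\top+\widehat{\boldsymbol W}$, $\widehat{\boldsymbol Y}=\frac{\mu}{\sqrt{2n}}yy^\top+\widehat{\boldsymbol Z}$, and $\{\widehat{\boldsymbol W}_{i,j},\widehat{\boldsymbol Z}_{i,j}:1\le i,j\le n\}$ are i.i.d. standard normal, independent of $(x,y)$. $\widehat{\mathbb Q}$ is the law of $(\widehat{\boldsymbol W},\widehat{\boldsymbol Z})$. **Low-degree advantage.** For laws $\mathbb P=\mathbb P_n,\mathbb Q=\mathbb Q_n$ of a pair of matrices, $\chi^2_{\le D}(\mathbb P;\mathbb Q):=\sup_{\deg f\le D}\frac{\mathbb E_{\mathbb P}[f]}{\sqrt{\mathbb E_{\mathbb Q}[f^2]}}$, the supremum being over nonzero real multivariate polynomials $f$ of degree at most $D$ in the entries of the two matrices. **Strong separation.** A sequence of polynomials $f=f_n$ strongly separates $\mathbb P_n$ and $\mathbb Q_n$ if, as $n\to\infty$,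 $\sqrt{\max\{\operatorname{Var}_{\mathbb P}(f),\operatorname{Var}_{\mathbb Q}(f)\}}=o\big(|\mathbb E_{\mathbb P}[f]-\mathbb E_{\mathbb Q}[f]|\big)$. *)

theory Defs
  imports
    "HOL-Probability.Probability"
    "HOL-Library.Poly_Mapping"
    "HOL-Library.Landau_Symbols"
begin

definition F :: "real \<Rightarrow> real \<Rightarrow> real \<Rightarrow> real \<Rightarrow> real" where
  "F lam mu rho gam =
     Max {lam\<^sup>2 / gam,
          mu\<^sup>2 / gam,
          lam\<^sup>2 * rho\<^sup>2 / (gam - lam\<^sup>2 + lam\<^sup>2 * rho\<^sup>2)
            + mu\<^sup>2 * rho\<^sup>2 / (gam - mu\<^sup>2 + mu\<^sup>2 * rho\<^sup>2)}"

text \<open>Sub-Gaussianity of a centred variable, in the moment generating function form.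
  Integrability is demanded explicitly because the Bochner integral of a non-integrable
  function is 0.\<close>

definition subgaussian :: "'a measure \<Rightarrow> real \<Rightarrow> ('a \<Rightarrow> real) \<Rightarrow> bool" where
  "subgaussian M K X \<longleftrightarrow>
     (\<forall>t. integrable M (\<lambda>w. exp (t * X w)) \<and>
          (\<integral>w. exp (t * X w) \<partial>M) \<le> exp (K\<^sup>2 * t\<^sup>2 / 2))"


subsection \<open>The model\<close>

type_synonym mat = "nat \<times> nat \<Rightarrow> real"

definition idx :: "nat \<Rightarrow> (nat \<times> nat) set" where
  "idx n = {1..n} \<times> {1..n}"

definition mat_space :: "nat \<Rightarrow> mat measure" where
  "mat_space n = (\<Pi>\<^sub>M ij\<in>idx n. borel)"

definition std_normal :: "real measure" where
  "std_normal = density lborel (\<lambda>x. ennreal (std_normal_density x))"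

definition gauss_mat :: "nat \<Rightarrow> mat measure" where
  "gauss_mat n = (\<Pi>\<^sub>M ij\<in>idx n. std_normal)"

definition hatQ :: "nat \<Rightarrow> (mat \<times> mat) measure" where
  "hatQ n = gauss_mat n \<Otimes>\<^sub>M gauss_mat n"

definition spiked :: "nat \<Rightarrow> real \<Rightarrow> (nat \<Rightarrow> real) \<Rightarrow> mat \<Rightarrow> mat" where
  "spiked n lam x W = (\<lambda>(i, j)\<in>idx n. lam / sqrt (2 * real n) * (x i * x j) + W (i, j))"

text \<open>The i.i.d. sample is a function \<open>v\<close> with \<open>v i = (x\<^sub>i, y\<^sub>i)\<close>; the product
  measure makes it independent of the noise.\<close>

definition hatP ::
    "real \<Rightarrow> real \<Rightarrow> (real \<times> real) measure \<Rightarrow> nat \<Rightarrow> (mat \<times> mat) measure" where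
  "hatP lam mu pistar n =
     distr ((\<Pi>\<^sub>M i\<in>{1..n}. pistar) \<Otimes>\<^sub>M hatQ n) (mat_space n \<Otimes>\<^sub>M mat_space n)
       (\<lambda>(v, W, Z). (spiked n lam (\<lambda>i. fst (v i)) W, spiked n mu (\<lambda>i. snd (v i)) Z))"


subsection \<open>Polynomials in the entries of two matrices\<close>

text \<open>The variable \<open>Inl (i, j)\<close> stands for the \<open>(i, j)\<close> entry of the first matrix and
  \<open>Inr (i, j)\<close> for that of the second. A monomial maps variables to exponents, a
  polynomial maps monomials to coefficients.\<close>

type_synonym entry = "nat \<times> nat + nat \<times> nat"
type_synonym mon = "entry \<Rightarrow>\<^sub>0 nat"
type_synonym mat_poly = "mon \<Rightarrow>\<^sub>0 real"

definition mon_degree :: "mon \<Rightarrow> nat" where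
  "mon_degree m = (\<Sum>v\<in>Poly_Mapping.keys m. Poly_Mapping.lookup m v)"

definition mon_eval :: "mon \<Rightarrow> mat \<times> mat \<Rightarrow> real" where
  "mon_eval m XY =
     (\<Prod>v\<in>Poly_Mapping.keys m. case_sum (fst XY) (snd XY) v ^ Poly_Mapping.lookup m v)"

definition poly_eval :: "mat_poly \<Rightarrow> mat \<times> mat \<Rightarrow> real" where
  "poly_eval p XY =
     (\<Sum>m\<in>Poly_Mapping.keys p. Poly_Mapping.lookup p m * mon_eval m XY)"

definition polys_le :: "nat \<Rightarrow> nat \<Rightarrow> mat_poly set" where
  "polys_le n D =
     {p. \<forall>m\<in>Poly_Mapping.keys p. Poly_Mapping.keys m \<subseteq> idx n <+> idx n \<and> mon_degree m \<le> D}"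


subsection \<open>Low-degree advantage and strong separation\<close>

definition mean :: "'a measure \<Rightarrow> ('a \<Rightarrow> real) \<Rightarrow> real" where
  "mean M g = (\<integral>w. g w \<partial>M)"

text \<open>The supremum is taken in the extended reals, so that it is \<open>\<infinity>\<close> rather than
  unspecified for an unbounded set of ratios.\<close>

definition chi2_le ::
    "nat \<Rightarrow> nat \<Rightarrow> (mat \<times> mat) measure \<Rightarrow> (mat \<times> mat) measure \<Rightarrow> ereal" where
  "chi2_le n D P Q =
     (SUP f \<in> polys_le n D - {0}.
        ereal (mean P (poly_eval f) / sqrt (mean Q (\<lambda>XY. (poly_eval f XY)\<^sup>2))))"

definition var :: "'a measure \<Rightarrow> ('a \<Rightarrow> real) \<Rightarrow> real" where
  "var M g = mean M (\<lambda>w. (g w - mean M g)\<^sup>2)"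

text \<open>In \<open>a\<^sub>n = o(b\<^sub>n)\<close> the comparison sequence is understood to be eventually nonzero
  (\<open>a\<^sub>n / b\<^sub>n \<rightarrow> 0\<close>). The library's \<open>o\<close> also relates the zero sequence to itself, under
  which constant polynomials would separate any two laws, hence the first conjunct.\<close>

definition strongly_separates ::
    "(nat \<Rightarrow> mat_poly) \<Rightarrow> (nat \<Rightarrow> (mat \<times> mat) measure) \<Rightarrow> (nat \<Rightarrow> (mat \<times> mat) measure) \<Rightarrow> bool"
  where
  "strongly_separates f P Q \<longleftrightarrow>
     (\<forall>\<^sub>F n in sequentially. mean (P n) (poly_eval (f n)) \<noteq> mean (Q n) (poly_eval (f n))) \<and>
     (\<lambda>n. sqrt (max (var (P n) (poly_eval (f n))) (var (Q n) (poly_eval (f n)))))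
       \<in> o(\<lambda>n. \<bar>mean (P n) (poly_eval (f n)) - mean (Q n) (poly_eval (f n))\<bar>)"

text \<open>\<open>D\<^sub>n = n\<^bsup>o(1)\<^esup>\<close>, read as an upper bound so that \<open>D\<^sub>n = 0\<close> is allowed.\<close>

definition n_pow_o1 :: "(nat \<Rightarrow> nat) \<Rightarrow> bool" where
  "n_pow_o1 D \<longleftrightarrow>
     (\<exists>e :: nat \<Rightarrow> real. e \<longlonglongrightarrow> 0 \<and> (\<forall>\<^sub>F n in sequentially. real (D n) \<le> real n powr e n))"

end

theory Submission
  imports Defs "HOL-Computational_Algebra.Polynomial" "HOL-Real_Asymp.Real_Asymp"
begin

text \<open>Expanding a polynomial in products of Hermite polynomials and applying Cauchy--Schwarz, the
  squared advantage is at most the sum over exponents \<open>\<alpha>\<close> of degree at most \<open>D\<close> of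
  \<open>(E s\<^bsup>\<alpha>\<^esup>)\<^sup>2 / \<alpha>!\<close>, where \<open>s\<close> is the spike. With independent copies \<open>(x', y')\<close> of \<open>(x, y)\<close>
  this equals the expectation of the exponential series, cut off at degree \<open>D\<close>, of
  \<open>(\<lambda>\<^sup>2 A\<^sup>2 + \<mu>\<^sup>2 B\<^sup>2) / 2\<close>, where \<open>A\<close> and \<open>B\<close> are the normalised overlaps of \<open>x, x'\<close> and of
  \<open>y, y'\<close>. Writing the even powers as moments of \<open>\<lambda> g A + \<mu> h B\<close> for standard normals \<open>g, h\<close> turns
  them into moments of a sum of i.i.d. centred variables with variance
  \<open>\<sigma>\<^sup>2 / n\<close>, \<open>\<sigma>\<^sup>2 = \<lambda>\<^sup>2 g\<^sup>2 + \<mu>\<^sup>2 h\<^sup>2 + 2 \<lambda> \<mu> \<rho>\<^sup>2 g h\<close>. As \<open>D = n\<^bsup>o(1)\<^esup>\<close>, the higher moments are negligible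
  and the sum is at most \<open>exp (1 + \<bar>g\<bar> + \<bar>h\<bar> + \<sigma>\<^sup>2 / 2)\<close>. This is integrable because \<open>F < 1\<close> says that
  the quadratic form \<open>g\<^sup>2 + h\<^sup>2 - \<sigma>\<^sup>2\<close> is positive definite.\<close>

subsection \<open>Variables with all moments\<close>

text \<open>Integrability alone is not preserved by products. Requiring every absolute moment gives
  a class closed under sums and products, so that integrability of any polynomial expression follows
  from introduction rules.\<close>

definition all_moments :: "'a measure \<Rightarrow> ('a \<Rightarrow> real) \<Rightarrow> bool" where
  "all_moments M f \<longleftrightarrow> f \<in> borel_measurable M \<and> (\<forall>k::nat. integrable M (\<lambda>x. \<bar>f x\<bar> ^ k))"

named_theorems all_moments_intros

lemma all_moments_measurable: "all_moments M f \<Longrightarrow> f \<in> borel_measurable M"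
  by (simp add: all_moments_def)

lemma all_moments_integrable_abs_power: "all_moments M f \<Longrightarrow> integrable M (\<lambda>x. \<bar>f x\<bar> ^ k)"
  by (simp add: all_moments_def)

lemma all_moments_integrable: "all_moments M f \<Longrightarrow> integrable M f"
  by (rule integrable_norm_cancel) (use all_moments_integrable_abs_power[of M f 1] all_moments_measurable[of M f] in simp_all)

lemma all_moments_const [all_moments_intros]: "finite_measure M \<Longrightarrow> all_moments M (\<lambda>x. c)"
  by (simp add: all_moments_def finite_measure.integrable_const)

lemma all_moments_mult [all_moments_intros]:
  assumes "all_moments M f" "all_moments M g"
  shows "all_moments M (\<lambda>x. f x * g x)"
  unfolding all_moments_def
proof (intro conjI allI)
  have [measurable]: "f \<in> borel_measurable M" "g \<in> borel_measurable M"
    using assms by (auto intro: all_moments_measurable)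
  show "(\<lambda>x. f x * g x) \<in> borel_measurable M" by measurable
  fix k :: nat
  have le: "(a * b) ^ k \<le> a ^ (2 * k) + b ^ (2 * k)" if "0 \<le> a" "0 \<le> b" for a b :: real
  proof -
    have "2 * (a ^ k * b ^ k) \<le> (a ^ k)\<^sup>2 + (b ^ k)\<^sup>2"
      using sum_squares_bound[of "a ^ k" "b ^ k"] by (simp add: mult.assoc)
    moreover have "0 \<le> a ^ k * b ^ k" using that by simp
    ultimately have "a ^ k * b ^ k \<le> (a ^ k)\<^sup>2 + (b ^ k)\<^sup>2" by linarith
    then show ?thesis by (simp add: power_mult_distrib power_even_eq)
  qed
  show "integrable M (\<lambda>x. \<bar>f x * g x\<bar> ^ k)"
  proof (rule Bochner_Integration.integrable_bound)
    show "integrable M (\<lambda>x. \<bar>f x\<bar> ^ (2 * k) + \<bar>g x\<bar> ^ (2 * k))"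
      using assms by (intro Bochner_Integration.integrable_add all_moments_integrable_abs_power)
    show "AE x in M. norm (\<bar>f x * g x\<bar> ^ k) \<le> norm (\<bar>f x\<bar> ^ (2 * k) + \<bar>g x\<bar> ^ (2 * k))"
      using le by (intro AE_I2) (simp add: abs_mult)
  qed measurable
qed

lemma all_moments_add [all_moments_intros]:
  assumes "all_moments M f" "all_moments M g"
  shows "all_moments M (\<lambda>x. f x + g x)"
  unfolding all_moments_def
proof (intro conjI allI)
  have [measurable]: "f \<in> borel_measurable M" "g \<in> borel_measurable M"
    using assms by (auto intro: all_moments_measurable)
  show "(\<lambda>x. f x + g x) \<in> borel_measurable M" by measurable
  fix k :: nat
  have le: "\<bar>a + b\<bar> ^ k \<le> 2 ^ k * (\<bar>a\<bar> ^ k + \<bar>b\<bar> ^ k)" for a b :: real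
  proof -
    have "\<bar>a + b\<bar> ^ k \<le> (2 * max \<bar>a\<bar> \<bar>b\<bar>) ^ k" by (intro power_mono) auto
    also have "\<dots> = 2 ^ k * (max \<bar>a\<bar> \<bar>b\<bar>) ^ k" by (simp add: power_mult_distrib)
    also have "(max \<bar>a\<bar> \<bar>b\<bar>) ^ k \<le> \<bar>a\<bar> ^ k + \<bar>b\<bar> ^ k" by (auto simp: max_def)
    finally show ?thesis by simp
  qed
  show "integrable M (\<lambda>x. \<bar>f x + g x\<bar> ^ k)"
  proof (rule Bochner_Integration.integrable_bound)
    show "integrable M (\<lambda>x. 2 ^ k * (\<bar>f x\<bar> ^ k + \<bar>g x\<bar> ^ k))"
      using assms by (intro integrable_mult_right Bochner_Integration.integrable_add all_moments_integrable_abs_power)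
    show "AE x in M. norm (\<bar>f x + g x\<bar> ^ k) \<le> norm (2 ^ k * (\<bar>f x\<bar> ^ k + \<bar>g x\<bar> ^ k))"
      using le by (intro AE_I2) simp
  qed measurable
qed

lemma all_moments_sum [all_moments_intros]:
  assumes "finite_measure M" "\<And>i. i \<in> I \<Longrightarrow> all_moments M (f i)"
  shows "all_moments M (\<lambda>x. \<Sum>i\<in>I. f i x)"
  using assms(2)
  by (induction I rule: infinite_finite_induct) (auto intro!: all_moments_intros assms(1))

lemma all_moments_prod [all_moments_intros]:
  assumes "finite_measure M" "\<And>i. i \<in> I \<Longrightarrow> all_moments M (f i)"
  shows "all_moments M (\<lambda>x. \<Prod>i\<in>I. f i x)"
  using assms(2)
  by (induction I rule: infinite_finite_induct) (auto intro!: all_moments_intros assms(1))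

lemma all_moments_power [all_moments_intros]:
  assumes "finite_measure M" "all_moments M f"
  shows "all_moments M (\<lambda>x. f x ^ k)"
  by (induction k) (auto intro!: all_moments_intros assms)

lemma all_moments_divide [all_moments_intros]:
  assumes "finite_measure M" "all_moments M f"
  shows "all_moments M (\<lambda>x. f x / c)"
  unfolding divide_inverse by (intro all_moments_intros assms)

lemma all_moments_diff [all_moments_intros]:
  assumes "finite_measure M" "all_moments M f" "all_moments M g"
  shows "all_moments M (\<lambda>x. f x - g x)"
  using all_moments_add[OF assms(2) all_moments_mult[OF all_moments_const[OF assms(1), of "-1"] assms(3)]]
  by simp

text \<open>Moments depend only on the law, and \<open>T\<close> preserves the measure. The lemmas
  on the two projections of a pair and on the components of a product are instances.\<close>

lemma all_moments_compose:
  assumes "T \<in> M \<rightarrow>\<^sub>M N" "distr M N T = N" "all_moments N f"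
  shows "all_moments M (\<lambda>x. f (T x))"
  unfolding all_moments_def
proof (intro conjI allI)
  have [measurable]: "f \<in> borel_measurable N" by (rule all_moments_measurable[OF assms(3)])
  show "(\<lambda>x. f (T x)) \<in> borel_measurable M" using assms(1) by measurable
  fix k
  have "integrable (distr M N T) (\<lambda>x. \<bar>f x\<bar> ^ k)"
    unfolding assms(2) by (rule all_moments_integrable_abs_power[OF assms(3)])
  then show "integrable M (\<lambda>x. \<bar>f (T x)\<bar> ^ k)"
    by (rule integrable_distr[OF assms(1)])
qed

lemma distr_pair_snd:
  assumes "prob_space M" "prob_space N"
  shows "distr (M \<Otimes>\<^sub>M N) N snd = N"
proof (rule measure_eqI)
  interpret M: prob_space M by fact
  interpret N: prob_space N by fact
  fix A assume "A \<in> sets (distr (M \<Otimes>\<^sub>M N) N snd)"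
  then have A: "A \<in> sets N" by simp
  have "emeasure (distr (M \<Otimes>\<^sub>M N) N snd) A = emeasure (M \<Otimes>\<^sub>M N) (space M \<times> A)"
    using A sets.sets_into_space[OF A]
    by (auto simp: emeasure_distr space_pair_measure intro!: arg_cong2[where f = emeasure])
  also have "\<dots> = emeasure N A" using A by (simp add: N.emeasure_pair_measure_Times M.emeasure_space_1)
  finally show "emeasure (distr (M \<Otimes>\<^sub>M N) N snd) A = emeasure N A" .
qed simp

lemma all_moments_fst:
  "prob_space N \<Longrightarrow> all_moments M f \<Longrightarrow> all_moments (M \<Otimes>\<^sub>M N) (\<lambda>x. f (fst x))"
  by (rule all_moments_compose[OF measurable_fst]) (auto intro: prob_space.distr_pair_fst)

lemma all_moments_snd:
  "prob_space M \<Longrightarrow> prob_space N \<Longrightarrow> all_moments N f \<Longrightarrow> all_moments (M \<Otimes>\<^sub>M N) (\<lambda>x. f (snd x))"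
  by (rule all_moments_compose[OF measurable_snd]) (auto intro: distr_pair_snd)

lemma all_moments_PiM_component:
  assumes "prob_space N" "i \<in> I" "all_moments N f"
  shows "all_moments (\<Pi>\<^sub>M i\<in>I. N) (\<lambda>x. f (x i))"
proof (rule all_moments_compose[OF measurable_component_singleton[OF assms(2)] _ assms(3)])
  interpret prob_space N by fact
  interpret product_prob_space "\<lambda>_. N" I by standard
  show "distr (\<Pi>\<^sub>M i\<in>I. N) N (\<lambda>\<omega>. \<omega> i) = N" by (rule PiM_component[OF assms(2)])
qed

section \<open>Factorisation of integrals over product measures\<close>

lemma integral_pair_mult:
  fixes f :: "'a \<Rightarrow> real" and g :: "'b \<Rightarrow> real"
  assumes "prob_space M" "prob_space N" "all_moments M f" "all_moments N g"
  shows "(\<integral>z. f (fst z) * g (snd z) \<partial>(M \<Otimes>\<^sub>M N)) = (\<integral>x. f x \<partial>M) * (\<integral>y. g y \<partial>N)"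
proof -
  interpret M: prob_space M by fact
  interpret N: prob_space N by fact
  interpret P: pair_sigma_finite M N ..
  have "finite_measure (M \<Otimes>\<^sub>M N)"
    using prob_space_pair[OF assms(1,2)] by (rule prob_space.finite_measure)
  then have "integrable (M \<Otimes>\<^sub>M N) (\<lambda>z. f (fst z) * g (snd z))"
    by (intro all_moments_integrable all_moments_intros all_moments_fst all_moments_snd assms)
  then have "(\<integral>z. f (fst z) * g (snd z) \<partial>(M \<Otimes>\<^sub>M N)) = (\<integral>x. (\<integral>y. f x * g y \<partial>N) \<partial>M)"
    by (subst P.integral_fst'[symmetric]) auto
  also have "\<dots> = (\<integral>x. f x \<partial>M) * (\<integral>y. g y \<partial>N)" by simp
  finally show ?thesis .
qed

lemma integral_PiM_prod:
  fixes f :: "'i \<Rightarrow> 'a \<Rightarrow> real"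
  assumes "prob_space N" "finite I" "\<And>i. i \<in> I \<Longrightarrow> integrable N (f i)"
  shows "(\<integral>x. (\<Prod>i\<in>I. f i (x i)) \<partial>(\<Pi>\<^sub>M i\<in>I. N)) = (\<Prod>i\<in>I. \<integral>x. f i x \<partial>N)"
proof -
  interpret prob_space N by fact
  interpret product_sigma_finite "\<lambda>_. N" ..
  show ?thesis by (rule product_integral_prod) (use assms in auto)
qed

subsection \<open>Hermite polynomials\<close>

text \<open>Membership in the linear span of a family of functions. Keeping the family
  \<open>h\<close> abstract serves both the univariate Hermite polynomials and their products over
  all matrix entries.\<close>

definition lincomb :: "'i set \<Rightarrow> ('i \<Rightarrow> 'a \<Rightarrow> real) \<Rightarrow> ('a \<Rightarrow> real) \<Rightarrow> bool" where
  "lincomb A h f \<longleftrightarrow> (\<exists>c. \<forall>x. f x = (\<Sum>a\<in>A. c a * h a x))"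

lemma lincomb_base:
  assumes "finite A" "a \<in> A"
  shows "lincomb A h (h a)"
  unfolding lincomb_def
proof (intro exI allI)
  fix x
  show "h a x = (\<Sum>b\<in>A. (if b = a then 1 else 0) * h b x)"
    using assms by (simp add: if_distrib[of "\<lambda>c. c * _"] cong: if_cong)
qed

lemma lincomb_0: "lincomb A h (\<lambda>x. 0)"
  unfolding lincomb_def by (rule exI[of _ "\<lambda>_. 0"]) simp

lemma lincomb_add:
  assumes "lincomb A h f" "lincomb A h g"
  shows "lincomb A h (\<lambda>x. f x + g x)"
proof -
  obtain c d where "\<forall>x. f x = (\<Sum>a\<in>A. c a * h a x)" "\<forall>x. g x = (\<Sum>a\<in>A. d a * h a x)"
    using assms unfolding lincomb_def by blast
  then have "\<forall>x. f x + g x = (\<Sum>a\<in>A. (c a + d a) * h a x)"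
    by (simp add: distrib_right sum.distrib)
  then show ?thesis unfolding lincomb_def by (intro exI)
qed

lemma lincomb_scale:
  assumes "lincomb A h f"
  shows "lincomb A h (\<lambda>x. r * f x)"
proof -
  obtain c where "\<forall>x. f x = (\<Sum>a\<in>A. c a * h a x)"
    using assms unfolding lincomb_def by blast
  then have "\<forall>x. r * f x = (\<Sum>a\<in>A. (r * c a) * h a x)"
    by (simp add: sum_distrib_left mult.assoc)
  then show ?thesis unfolding lincomb_def by (intro exI)
qed

lemma lincomb_sum:
  assumes "\<And>i. i \<in> I \<Longrightarrow> lincomb A h (f i)"
  shows "lincomb A h (\<lambda>x. \<Sum>i\<in>I. f i x)"
  using assms
  by (induction I rule: infinite_finite_induct) (auto intro: lincomb_0 lincomb_add)

section \<open>Moments of the standard normal law\<close>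

lemma prob_space_std_normal: "prob_space std_normal"
  unfolding std_normal_def by (rule prob_space_normal_density) simp

lemma sets_std_normal [measurable_cong, simp]: "sets std_normal = sets borel"
  by (simp add: std_normal_def)

lemma space_std_normal [simp]: "space std_normal = UNIV"
  by (simp add: std_normal_def)

lemma finite_measure_std_normal: "finite_measure std_normal"
  using prob_space_std_normal by (rule prob_space.finite_measure)

lemma integral_std_normal:
  assumes "f \<in> borel_measurable borel"
  shows "(\<integral>x. f x \<partial>std_normal) = (\<integral>x. std_normal_density x * f x \<partial>lborel)"
  unfolding std_normal_def using assms
  by (subst integral_density) (auto simp: normal_density_nonneg)

lemma integrable_std_normal_iff:
  fixes f :: "real \<Rightarrow> real"
  assumes "f \<in> borel_measurable borel"
  shows "integrable std_normal f \<longleftrightarrow> integrable lborel (\<lambda>x. std_normal_density x * f x)"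
  unfolding std_normal_def using assms
  by (subst integrable_density) (auto simp: normal_density_nonneg)

lemma all_moments_std_normal: "all_moments std_normal (\<lambda>x. x)"
  unfolding all_moments_def
  by (auto simp: integrable_std_normal_iff integrable_std_normal_moment_abs)

lemma std_normal_even_moment: "(\<integral>x. x ^ (2 * k) \<partial>std_normal) = fact (2 * k) / (2 ^ k * fact k)"
  by (simp add: integral_std_normal integral_std_normal_moment_even)

lemma std_normal_odd_moment: "odd k \<Longrightarrow> (\<integral>x. x ^ k \<partial>std_normal) = 0"
  using integral_std_normal_moment_odd by (auto simp: integral_std_normal elim!: oddE)

lemma all_moments_poly: "all_moments std_normal (poly p)"
  unfolding poly_altdef
  by (intro all_moments_intros all_moments_std_normal finite_measure_std_normal)

lemma integrable_poly: "integrable std_normal (poly p)"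
  by (rule all_moments_integrable[OF all_moments_poly])

text \<open>Gaussian integration by parts for monomials, read off from the closed form of the
  moments. At \<open>k = 0\<close> the truncated \<open>k - 1\<close> is harmless because the factor
  \<open>real k\<close> vanishes.\<close>

lemma std_normal_moment_Suc:
  "(\<integral>x. x ^ Suc k \<partial>std_normal) = real k * (\<integral>x. x ^ (k - 1) \<partial>std_normal)"
proof (cases "even k")
  case True
  then show ?thesis
    by (cases "k = 0") (simp_all add: std_normal_odd_moment del: power_Suc, simp add: std_normal_odd_moment[of 1, simplified])
next
  case False
  then obtain j where k: "k = 2 * j + 1" by (elim oddE)
  have "(\<integral>x. x ^ Suc k \<partial>std_normal) = fact (2 * (j + 1)) / (2 ^ (j + 1) * fact (j + 1))"
    using std_normal_even_moment[of "j + 1"] by (simp add: k)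
  also have "\<dots> = real k * (fact (2 * j) / (2 ^ j * fact j))"
    by (simp add: k divide_simps)
  finally show ?thesis using std_normal_even_moment[of j] by (simp add: k)
qed

section \<open>Gaussian integration by parts and the Hermite polynomials\<close>

definition gexp :: "real poly \<Rightarrow> real" where
  "gexp p = (\<integral>x. poly p x \<partial>std_normal)"

lemma gexp_add: "gexp (p + q) = gexp p + gexp q"
  by (simp add: gexp_def Bochner_Integration.integral_add integrable_poly)

lemma gexp_diff: "gexp (p - q) = gexp p - gexp q"
  by (simp add: gexp_def Bochner_Integration.integral_diff integrable_poly)

lemma gexp_smult: "gexp (smult c p) = c * gexp p"
  by (simp add: gexp_def)

lemma gexp_sum: "gexp (\<Sum>i\<in>I. f i) = (\<Sum>i\<in>I. gexp (f i))"
  by (induction I rule: infinite_finite_induct) (auto simp: gexp_add, simp_all add: gexp_def)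

lemma gexp_1: "gexp 1 = 1"
  using prob_space.prob_space[OF prob_space_std_normal] by (simp add: gexp_def)

lemma pderiv_sum: "pderiv (\<Sum>i\<in>I. f i) = (\<Sum>i\<in>I. pderiv (f i))"
  by (induction I rule: infinite_finite_induct) (auto simp: pderiv_add)

text \<open>Since \<open>pCons 0 p\<close> is the polynomial \<open>x * p(x)\<close>, this is
  Stein's identity. Both sides are linear in \<open>p\<close>, so monomials suffice.\<close>

lemma gexp_pCons_0: "gexp (pCons 0 p) = gexp (pderiv p)"
proof -
  have mon: "gexp (pCons 0 (monom c i)) = gexp (pderiv (monom c i))" for c i
  proof -
    have "gexp (pCons 0 (monom c i)) = c * (\<integral>x. x ^ Suc i \<partial>std_normal)"
      by (simp add: gexp_def poly_monom mult.left_commute[of _ c])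
    also have "\<dots> = gexp (pderiv (monom c i))"
      by (simp add: std_normal_moment_Suc gexp_def poly_monom pderiv_monom mult.assoc mult.left_commute del: power_Suc)
    finally show ?thesis .
  qed
  have pC: "pCons 0 (\<Sum>i\<in>I. f i) = (\<Sum>i\<in>I. pCons 0 (f i))" for I :: "nat set" and f :: "nat \<Rightarrow> real poly"
  proof (induction I rule: infinite_finite_induct)
    case (insert x I)
    have "pCons 0 (f x + sum f I) = pCons 0 (f x) + pCons 0 (sum f I)" by simp
    then show ?case using insert by simp
  qed simp_all
  show ?thesis
    by (subst (1 2) poly_as_sum_of_monoms[of p, symmetric])
      (simp add: pderiv_sum pC gexp_sum mon)
qed

text \<open>The probabilists' Hermite polynomials, generated by the raising operator
  \<open>p |-> x p - p'\<close>. By Stein's identity this operator is the adjoint of differentiation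
  under the standard normal law.\<close>

fun hermite :: "nat \<Rightarrow> real poly" where
  "hermite 0 = 1"
| "hermite (Suc k) = pCons 0 (hermite k) - pderiv (hermite k)"

text \<open>The commutator of differentiation with the raising operator is the identity, so each
  step of the recursion contributes one more copy of \<open>hermite k\<close>.\<close>

lemma pderiv_hermite_Suc: "pderiv (hermite (Suc k)) = smult (real (Suc k)) (hermite k)"
proof (induction k)
  case (Suc k)
  have "pderiv (hermite (Suc (Suc k))) =
      hermite (Suc k) + pCons 0 (pderiv (hermite (Suc k))) - pderiv (pderiv (hermite (Suc k)))"
    by (simp add: pderiv_pCons pderiv_diff)
  also have "\<dots> = hermite (Suc k) + smult (real (Suc k)) (hermite (Suc k))"
    unfolding Suc.IH by (simp add: pderiv_smult smult_diff_right)
  also have "\<dots> = smult (real (Suc (Suc k))) (hermite (Suc k))"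
  proof -
    have "real (Suc (Suc k)) = 1 + real (Suc k)" by simp
    then show ?thesis by (simp only: smult_add_left smult_1_left)
  qed
  finally show ?case .
qed (simp add: pderiv_pCons)

text \<open>Adjointness of raising and differentiation: Stein's identity is applied to
  \<open>hermite k * q\<close>, and one half of the product rule cancels the subtracted
  derivative.\<close>

lemma gexp_hermite_Suc_mult: "gexp (hermite (Suc k) * q) = gexp (hermite k * pderiv q)"
proof -
  have "gexp (hermite (Suc k) * q) = gexp (pCons 0 (hermite k * q)) - gexp (pderiv (hermite k) * q)"
    by (simp add: gexp_diff[symmetric] left_diff_distrib mult_pCons_left)
  also have "\<dots> = gexp (hermite k * pderiv q)"
    by (simp add: gexp_pCons_0 pderiv_mult gexp_diff[symmetric] algebra_simps)
  finally show ?thesis .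
qed

text \<open>Adjointness strips one raising operator from the left factor and differentiates the
  right one, which lowers both indices and produces the factor \<open>k\<close>. If one index
  reaches 0 first, a constant is differentiated.\<close>

lemma gexp_hermite_mult: "gexp (hermite j * hermite k) = (if j = k then fact k else 0)"
proof (induction j arbitrary: k)
  case 0
  show ?case
  proof (cases k)
    case (Suc k')
    then show ?thesis using gexp_hermite_Suc_mult[of k' 1] by (simp add: gexp_def)
  qed (simp add: gexp_1)
next
  case (Suc j)
  show ?case
  proof (cases k)
    case 0
    then show ?thesis using gexp_hermite_Suc_mult[of j 1] by (simp add: gexp_def)
  next
    case (Suc k')
    then show ?thesis
      by (simp only: gexp_hermite_Suc_mult pderiv_hermite_Suc mult_smult_right gexp_smult Suc.IH) simp
  qed
qed

lemma pderiv_pcompose_shift: "pderiv (pcompose p [:s, 1:]) = pcompose (pderiv p) [:s, 1:]"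
  by (simp add: pderiv_pcompose pderiv_pCons)

text \<open>Composition with \<open>[:s, 1:]\<close> translates by \<open>s\<close>. In the
  translated recursion the part \<open>x p - p'\<close> has Gaussian mean 0 by Stein's identity, so
  that each step only multiplies by \<open>s\<close>.\<close>

lemma gexp_hermite_shift: "gexp (pcompose (hermite k) [:s, 1:]) = s ^ k"
proof (induction k)
  case (Suc k)
  have "pcompose (hermite (Suc k)) [:s, 1:] = smult s (pcompose (hermite k) [:s, 1:])
      + (pCons 0 (pcompose (hermite k) [:s, 1:]) - pderiv (pcompose (hermite k) [:s, 1:]))"
    by (simp add: pcompose_diff pcompose_pCons pderiv_pcompose_shift)
  then show ?case by (simp add: gexp_add gexp_diff gexp_smult gexp_pCons_0 Suc.IH)
qed (simp add: gexp_1 pcompose_1)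

lemma integral_hermite_mult:
  "(\<integral>x. poly (hermite j) x * poly (hermite k) x \<partial>std_normal) = (if j = k then fact k else 0)"
  using gexp_hermite_mult[of j k] by (simp add: gexp_def)

lemma integral_hermite_shift: "(\<integral>x. poly (hermite k) (s + x) \<partial>std_normal) = s ^ k"
  using gexp_hermite_shift[of k s] by (simp add: gexp_def poly_pcompose)

text \<open>Induction on the power, multiplying an expansion by \<open>x\<close> with the three-term
  recurrence \<open>x H_j = H_(j+1) + j H_(j-1)\<close>.\<close>

lemma lincomb_hermite_power: "lincomb {..m} (\<lambda>j. poly (hermite j)) (\<lambda>x. x ^ m)"
proof (induction m)
  case 0
  have "(\<lambda>x::real. x ^ 0) = poly (hermite 0)" by (rule ext) simp
  then show ?case by (simp only:) (rule lincomb_base; simp)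
next
  case (Suc m)
  let ?h = "\<lambda>j. poly (hermite j)"
  have h: "lincomb {..Suc m} ?h (\<lambda>x. x * poly (hermite j) x)" if "j \<le> m" for j
  proof (cases j)
    case 0
    then have "(\<lambda>x. x * poly (hermite j) x) = ?h (Suc 0)" by (intro ext) simp
    then show ?thesis by (simp only:) (rule lincomb_base; simp)
  next
    case (Suc i)
    have "(\<lambda>x. x * poly (hermite j) x) = (\<lambda>x. poly (hermite (Suc j)) x + real (Suc i) * poly (hermite i) x)"
      by (subst hermite.simps) (simp only: Suc pderiv_hermite_Suc, simp)
    moreover have "lincomb {..Suc m} ?h (\<lambda>x. poly (hermite (Suc j)) x + real (Suc i) * poly (hermite i) x)"
      using that Suc by (intro lincomb_add lincomb_scale lincomb_base) auto
    ultimately show ?thesis by simp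
  qed
  obtain c where c: "\<And>x. x ^ m = (\<Sum>j\<le>m. c j * poly (hermite j) x)"
    using Suc.IH unfolding lincomb_def by blast
  have "(\<lambda>x. x ^ Suc m) = (\<lambda>x. \<Sum>j\<le>m. c j * (x * poly (hermite j) x))"
    by (simp add: c sum_distrib_left mult.left_commute)
  then show ?case using h by (simp only:) (intro lincomb_sum lincomb_scale, auto)
qed

subsection \<open>The multinomial theorem\<close>

text \<open>The restriction to \<open>extensional I\<close> gives each exponent vector on
  \<open>I\<close> exactly one representative, so that for finite \<open>I\<close> the set is finite
  and can serve as a summation range.\<close>

definition multi_exps :: "'i set \<Rightarrow> nat \<Rightarrow> ('i \<Rightarrow> nat) set" where
  "multi_exps I d = {\<alpha> \<in> extensional I. sum \<alpha> I = d}"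

lemma multi_exps_subset_PiE:
  assumes "finite I" "d \<le> m"
  shows "multi_exps I d \<subseteq> Pi\<^sub>E I (\<lambda>_. {..m})"
proof
  fix \<alpha> assume \<alpha>: "\<alpha> \<in> multi_exps I d"
  have "\<alpha> i \<le> m" if "i \<in> I" for i
    using member_le_sum[OF that, of \<alpha>] assms \<alpha> by (simp add: multi_exps_def)
  then show "\<alpha> \<in> Pi\<^sub>E I (\<lambda>_. {..m})" using \<alpha> by (simp add: multi_exps_def PiE_iff)
qed

lemma finite_multi_exps: "finite I \<Longrightarrow> finite (multi_exps I d)"
  by (rule finite_subset[OF multi_exps_subset_PiE[OF _ order_refl]]) (auto intro: finite_PiE)

text \<open>Induction on \<open>I\<close>: the exponent of the new index is split off, the remaining
  ones are summed by the induction hypothesis, and the binomial theorem collects the result.\<close>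

lemma multinomial_theorem:
  fixes u :: "'i \<Rightarrow> real"
  assumes "finite I"
  shows "(\<Sum>\<alpha>\<in>multi_exps I d. \<Prod>v\<in>I. u v ^ \<alpha> v / fact (\<alpha> v)) = sum u I ^ d / fact d"
  using assms
proof (induction I arbitrary: d)
  case empty
  have "multi_exps ({} :: 'i set) d = (if d = 0 then {\<lambda>_. undefined} else {})"
    by (auto simp: multi_exps_def)
  then show ?case by simp
next
  case (insert x I)
  let ?f = "\<lambda>I \<alpha>. \<Prod>v\<in>I. u v ^ \<alpha> v / fact (\<alpha> v)"
  have "(\<Sum>\<alpha>\<in>multi_exps (insert x I) d. ?f (insert x I) \<alpha>) =
      (\<Sum>(k, \<beta>)\<in>Sigma {..d} (\<lambda>k. multi_exps I (d - k)). u x ^ k / fact k * ?f I \<beta>)"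
  \<comment> \<open>Resetting the removed coordinate to \<open>undefined\<close> keeps the remaining
    exponent vector extensional on \<open>I\<close>.\<close>
  proof (rule sum.reindex_bij_witness[of _ "\<lambda>(k, \<beta>). \<beta>(x := k)" "\<lambda>\<alpha>. (\<alpha> x, \<alpha>(x := undefined))"])
    fix \<alpha> assume \<alpha>: "\<alpha> \<in> multi_exps (insert x I) d"
    have s: "sum (\<alpha>(x := undefined)) I = sum \<alpha> I" using insert by (intro sum.cong) auto
    show "(\<lambda>(k, \<beta>). \<beta>(x := k)) (\<alpha> x, \<alpha>(x := undefined)) = \<alpha>" by simp
    show "(\<alpha> x, \<alpha>(x := undefined)) \<in> Sigma {..d} (\<lambda>k. multi_exps I (d - k))"
      using \<alpha> insert s by (auto simp: multi_exps_def extensional_def)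
    have "?f I (\<alpha>(x := undefined)) = ?f I \<alpha>"
      using insert by (intro prod.cong) auto
    then show "(\<lambda>(k, \<beta>). u x ^ k / fact k * ?f I \<beta>) (\<alpha> x, \<alpha>(x := undefined)) = ?f (insert x I) \<alpha>"
      using insert by simp
  next
    fix k\<beta> assume "k\<beta> \<in> Sigma {..d} (\<lambda>k. multi_exps I (d - k))"
    then obtain k \<beta> where k\<beta>: "k\<beta> = (k, \<beta>)" "k \<le> d" "\<beta> \<in> multi_exps I (d - k)" by auto
    have s: "sum (\<beta>(x := k)) I = sum \<beta> I" using insert by (intro sum.cong) auto
    show "(\<lambda>(k, \<beta>). \<beta>(x := k)) k\<beta> \<in> multi_exps (insert x I) d"
      using k\<beta> insert s by (auto simp: multi_exps_def extensional_def)
    have "\<beta> x = undefined" using k\<beta> insert by (auto simp: multi_exps_def extensional_def)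
    then show "(\<lambda>\<alpha>. (\<alpha> x, \<alpha>(x := undefined))) ((\<lambda>(k, \<beta>). \<beta>(x := k)) k\<beta>) = k\<beta>"
      using k\<beta> by (simp add: fun_upd_idem)
  qed
  also have "\<dots> = (\<Sum>k\<le>d. \<Sum>\<beta>\<in>multi_exps I (d - k). u x ^ k / fact k * ?f I \<beta>)"
    using insert by (subst sum.Sigma) (auto intro: finite_multi_exps)
  also have "\<dots> = (\<Sum>k\<le>d. u x ^ k / fact k * (sum u I ^ (d - k) / fact (d - k)))"
    by (intro sum.cong refl) (simp only: sum_distrib_left[symmetric] insert.IH)
  also have "\<dots> = (\<Sum>k\<le>d. real (d choose k) * u x ^ k * sum u I ^ (d - k)) / fact d"
    unfolding sum_divide_distrib
    by (intro sum.cong) (auto simp: binomial_fact field_simps)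
  also have "\<dots> = sum u (insert x I) ^ d / fact d"
    using insert by (simp add: binomial_ring)
  finally show ?case .
qed

text \<open>As all terms are nonnegative, the constraint on the total degree can be relaxed to a
  bound on each coordinate; the sum over the resulting box factorises.\<close>

lemma sum_multi_exps_prod_le:
  fixes c :: "nat \<Rightarrow> real"
  assumes "finite I" "\<And>k. c k \<ge> 0"
  shows "(\<Sum>p\<le>m. \<Sum>\<alpha>\<in>multi_exps I p. \<Prod>i\<in>I. c (\<alpha> i)) \<le> (\<Sum>k\<le>m. c k) ^ card I"
proof -
  have "(\<Sum>p\<le>m. \<Sum>\<alpha>\<in>multi_exps I p. \<Prod>i\<in>I. c (\<alpha> i)) = (\<Sum>\<alpha>\<in>(\<Union>p\<le>m. multi_exps I p). \<Prod>i\<in>I. c (\<alpha> i))"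
    using assms by (intro sum.UNION_disjoint[symmetric]) (auto simp: finite_multi_exps, auto simp: multi_exps_def)
  also have "\<dots> \<le> (\<Sum>\<alpha>\<in>Pi\<^sub>E I (\<lambda>_. {..m}). \<Prod>i\<in>I. c (\<alpha> i))"
  proof (rule sum_mono2)
    show "(\<Union>p\<le>m. multi_exps I p) \<subseteq> Pi\<^sub>E I (\<lambda>_. {..m})"
      using assms(1) by (intro UN_least multi_exps_subset_PiE) auto
  qed (use assms in \<open>auto intro!: finite_PiE prod_nonneg\<close>)
  also have "\<dots> = (\<Sum>k\<le>m. c k) ^ card I"
    using assms by (subst prod_sum_PiE[symmetric]) auto
  finally show ?thesis .
qed

subsection \<open>The Hermite expansion under the two laws\<close>

definition vars :: "nat \<Rightarrow> entry set" where
  "vars n = idx n <+> idx n"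

definition coord :: "mat \<times> mat \<Rightarrow> entry \<Rightarrow> real" where
  "coord XY v = case_sum (fst XY) (snd XY) v"

definition exps_le :: "nat \<Rightarrow> nat \<Rightarrow> (entry \<Rightarrow> nat) set" where
  "exps_le n D = (\<Union>d\<le>D. multi_exps (vars n) d)"

definition herm_prod :: "nat \<Rightarrow> (entry \<Rightarrow> nat) \<Rightarrow> mat \<times> mat \<Rightarrow> real" where
  "herm_prod n \<alpha> XY = (\<Prod>v\<in>vars n. poly (hermite (\<alpha> v)) (coord XY v))"

lemma finite_idx: "finite (idx n)" by (simp add: idx_def)
lemma finite_vars: "finite (vars n)" by (simp add: vars_def finite_idx)
lemma finite_exps_le: "finite (exps_le n D)" by (simp add: exps_le_def finite_multi_exps finite_vars)

text \<open>Each power \<open>x ^ k\<close> expands into Hermite polynomials of index at most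
  \<open>k\<close>. Multiplying the expansions out therefore produces only exponents below those of
  \<open>m\<close>, and the total degree does not grow.\<close>

lemma lincomb_mon_eval:
  assumes "Poly_Mapping.keys m \<subseteq> vars n" "mon_degree m \<le> D"
  shows "lincomb (exps_le n D) (herm_prod n) (mon_eval m)"
proof -
  let ?e = "Poly_Mapping.lookup m"
  have "\<exists>a. \<forall>k x. x ^ k = (\<Sum>j\<le>k. a k j * poly (hermite j) x)"
    using lincomb_hermite_power unfolding lincomb_def by metis
  then obtain a where a: "\<And>k x. x ^ k = (\<Sum>j\<le>k. a k j * poly (hermite j) x)" by blast
  have eq: "mon_eval m XY = (\<Sum>g\<in>Pi\<^sub>E (vars n) (\<lambda>v. {..?e v}). (\<Prod>v\<in>vars n. a (?e v) (g v)) * herm_prod n g XY)" for XY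
  proof -
    have "mon_eval m XY = (\<Prod>v\<in>vars n. coord XY v ^ ?e v)"
      unfolding mon_eval_def coord_def using assms(1) finite_vars
      by (intro prod.mono_neutral_left) (auto simp: in_keys_iff)
    also have "\<dots> = (\<Prod>v\<in>vars n. \<Sum>j\<le>?e v. a (?e v) j * poly (hermite j) (coord XY v))"
      by (subst a) simp
    also have "\<dots> = (\<Sum>g\<in>Pi\<^sub>E (vars n) (\<lambda>v. {..?e v}). \<Prod>v\<in>vars n. a (?e v) (g v) * poly (hermite (g v)) (coord XY v))"
      by (rule prod_sum_PiE) (auto simp: finite_vars)
    finally show ?thesis by (simp add: prod.distrib herm_prod_def)
  qed
  have "Pi\<^sub>E (vars n) (\<lambda>v. {..?e v}) \<subseteq> exps_le n D"
  proof
    fix g assume g: "g \<in> Pi\<^sub>E (vars n) (\<lambda>v. {..?e v})"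
    have "sum g (vars n) \<le> sum ?e (vars n)" using g by (intro sum_mono) (auto simp: PiE_iff)
    also have "\<dots> = mon_degree m"
      unfolding mon_degree_def using assms(1) finite_vars
      by (intro sum.mono_neutral_right) (auto simp: in_keys_iff)
    finally show "g \<in> exps_le n D" using assms(2) g by (auto simp: exps_le_def multi_exps_def PiE_iff)
  qed
  moreover have "mon_eval m = (\<lambda>XY. \<Sum>g\<in>Pi\<^sub>E (vars n) (\<lambda>v. {..?e v}). (\<Prod>v\<in>vars n. a (?e v) (g v)) * herm_prod n g XY)"
    using eq by blast
  ultimately show ?thesis
    by (simp only:) (intro lincomb_sum lincomb_scale lincomb_base finite_exps_le; blast)
qed

lemma lincomb_poly_eval:
  assumes "f \<in> polys_le n D"
  shows "lincomb (exps_le n D) (herm_prod n) (poly_eval f)"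
proof -
  have "poly_eval f = (\<lambda>XY. \<Sum>m\<in>Poly_Mapping.keys f. Poly_Mapping.lookup f m * mon_eval m XY)"
    by (rule ext) (simp add: poly_eval_def)
  then show ?thesis using assms
    by (simp only:) (intro lincomb_sum lincomb_scale lincomb_mon_eval; simp add: polys_le_def vars_def)
qed

lemma prob_space_PiM_const: "prob_space N \<Longrightarrow> prob_space (\<Pi>\<^sub>M i\<in>I. N)"
  by (intro prob_space_PiM)

lemma prob_space_gauss_mat: "prob_space (gauss_mat n)"
  unfolding gauss_mat_def by (intro prob_space_PiM_const prob_space_std_normal)

lemma prob_space_hatQ: "prob_space (hatQ n)"
  unfolding hatQ_def by (intro prob_space_pair prob_space_gauss_mat)

lemma finite_measure_hatQ: "finite_measure (hatQ n)"
  using prob_space_hatQ by (rule prob_space.finite_measure)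

lemma sets_gauss_mat [measurable_cong]: "sets (gauss_mat n) = sets (mat_space n)"
  unfolding gauss_mat_def mat_space_def by (intro sets_PiM_cong) auto

lemma sets_hatQ [measurable_cong]: "sets (hatQ n) = sets (mat_space n \<Otimes>\<^sub>M mat_space n)"
  unfolding hatQ_def by (intro sets_pair_measure_cong sets_gauss_mat)

lemma all_moments_gauss_mat:
  assumes "ij \<in> idx n" "all_moments std_normal \<phi>"
  shows "all_moments (gauss_mat n) (\<lambda>W. \<phi> (W ij))"
  unfolding gauss_mat_def by (intro all_moments_PiM_component prob_space_std_normal assms)

lemma all_moments_hatQ_coord:
  assumes "v \<in> vars n" "all_moments std_normal \<phi>"
  shows "all_moments (hatQ n) (\<lambda>XY. \<phi> (coord XY v))"
proof (cases v)
  case (Inl ij)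
  have "all_moments (hatQ n) (\<lambda>XY. (\<lambda>W. \<phi> (W ij)) (fst XY))" unfolding hatQ_def
    using assms Inl by (intro all_moments_fst prob_space_gauss_mat all_moments_gauss_mat) (auto simp: vars_def)
  then show ?thesis by (simp add: coord_def Inl)
next
  case (Inr ij)
  have "all_moments (hatQ n) (\<lambda>XY. (\<lambda>W. \<phi> (W ij)) (snd XY))" unfolding hatQ_def
    using assms Inr by (intro all_moments_snd prob_space_gauss_mat all_moments_gauss_mat) (auto simp: vars_def)
  then show ?thesis by (simp add: coord_def Inr)
qed

lemma integral_gauss_mat_prod:
  assumes "\<And>ij. ij \<in> idx n \<Longrightarrow> all_moments std_normal (\<phi> ij)"
  shows "(\<integral>W. (\<Prod>ij\<in>idx n. \<phi> ij (W ij)) \<partial>gauss_mat n) = (\<Prod>ij\<in>idx n. \<integral>x. \<phi> ij x \<partial>std_normal)"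
  unfolding gauss_mat_def
  by (intro integral_PiM_prod prob_space_std_normal finite_idx all_moments_integrable assms)

lemma integral_hatQ_prod:
  assumes "\<And>v. v \<in> vars n \<Longrightarrow> all_moments std_normal (\<phi> v)"
  shows "(\<integral>XY. (\<Prod>v\<in>vars n. \<phi> v (coord XY v)) \<partial>hatQ n) = (\<Prod>v\<in>vars n. \<integral>x. \<phi> v x \<partial>std_normal)"
proof -
  let ?f = "\<lambda>W. \<Prod>ij\<in>idx n. \<phi> (Inl ij) (W ij)" and ?g = "\<lambda>W. \<Prod>ij\<in>idx n. \<phi> (Inr ij) (W ij)"
  have fin: "finite_measure (gauss_mat n)" by (rule prob_space.finite_measure[OF prob_space_gauss_mat])
  have "all_moments (gauss_mat n) ?f" "all_moments (gauss_mat n) ?g"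
    by (auto intro!: all_moments_intros fin all_moments_gauss_mat assms simp: vars_def)
  then have "(\<integral>XY. ?f (fst XY) * ?g (snd XY) \<partial>hatQ n) = (\<integral>W. ?f W \<partial>gauss_mat n) * (\<integral>W. ?g W \<partial>gauss_mat n)"
    unfolding hatQ_def by (intro integral_pair_mult prob_space_gauss_mat)
  also have "(\<integral>W. ?f W \<partial>gauss_mat n) = (\<Prod>ij\<in>idx n. \<integral>x. \<phi> (Inl ij) x \<partial>std_normal)"
    by (intro integral_gauss_mat_prod assms) (auto simp: vars_def)
  also have "(\<integral>W. ?g W \<partial>gauss_mat n) = (\<Prod>ij\<in>idx n. \<integral>x. \<phi> (Inr ij) x \<partial>std_normal)"
    by (intro integral_gauss_mat_prod assms) (auto simp: vars_def)
  finally show ?thesis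
    by (simp add: vars_def prod.Plus finite_idx coord_def)
qed

lemma all_moments_herm_prod_hatQ: "all_moments (hatQ n) (herm_prod n \<alpha>)"
  unfolding herm_prod_def
  by (intro all_moments_intros finite_measure_hatQ all_moments_hatQ_coord all_moments_poly)

lemma integral_herm_prod_mult:
  assumes "\<alpha> \<in> exps_le n D" "\<beta> \<in> exps_le n D"
  shows "(\<integral>XY. herm_prod n \<alpha> XY * herm_prod n \<beta> XY \<partial>hatQ n) =
    (if \<alpha> = \<beta> then \<Prod>v\<in>vars n. fact (\<alpha> v) else 0)"
proof -
  have "(\<integral>XY. herm_prod n \<alpha> XY * herm_prod n \<beta> XY \<partial>hatQ n) =
      (\<integral>XY. (\<Prod>v\<in>vars n. (\<lambda>x. poly (hermite (\<alpha> v)) x * poly (hermite (\<beta> v)) x) (coord XY v)) \<partial>hatQ n)"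
    by (simp add: herm_prod_def prod.distrib)
  also have "\<dots> = (\<Prod>v\<in>vars n. if \<alpha> v = \<beta> v then fact (\<alpha> v) else 0)"
    by (subst integral_hatQ_prod) (auto simp: integral_hermite_mult intro!: all_moments_intros all_moments_poly prod.cong)
  also have "\<dots> = (if \<alpha> = \<beta> then \<Prod>v\<in>vars n. fact (\<alpha> v) else 0)"
  proof (cases "\<alpha> = \<beta>")
    case False
    \<comment> \<open>Extensionality ensures that distinct exponents already differ at a variable in
      \<open>vars n\<close>; the factor there vanishes by orthogonality.\<close>
    have "\<alpha> \<in> extensional (vars n)" "\<beta> \<in> extensional (vars n)"
      using assms by (auto simp: exps_le_def multi_exps_def)
    then obtain v where "v \<in> vars n" "\<alpha> v \<noteq> \<beta> v" using False extensionalityI by blast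
    then show ?thesis using False finite_vars by (auto intro!: prod_zero)
  qed simp
  finally show ?thesis .
qed

text \<open>Parseval's identity for the orthogonal family of Hermite products.\<close>

lemma integral_lincomb_square:
  "(\<integral>XY. (\<Sum>\<alpha>\<in>exps_le n D. c \<alpha> * herm_prod n \<alpha> XY)\<^sup>2 \<partial>hatQ n) =
    (\<Sum>\<alpha>\<in>exps_le n D. (c \<alpha>)\<^sup>2 * (\<Prod>v\<in>vars n. fact (\<alpha> v)))"
proof -
  let ?A = "exps_le n D"
  have "(\<integral>XY. (\<Sum>\<alpha>\<in>?A. c \<alpha> * herm_prod n \<alpha> XY)\<^sup>2 \<partial>hatQ n) =
      (\<integral>XY. (\<Sum>\<alpha>\<in>?A. \<Sum>\<beta>\<in>?A. c \<alpha> * c \<beta> * (herm_prod n \<alpha> XY * herm_prod n \<beta> XY)) \<partial>hatQ n)"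
    by (simp add: power2_eq_square sum_product algebra_simps)
  also have "\<dots> = (\<Sum>\<alpha>\<in>?A. \<Sum>\<beta>\<in>?A. c \<alpha> * c \<beta> * (\<integral>XY. herm_prod n \<alpha> XY * herm_prod n \<beta> XY \<partial>hatQ n))"
    by (subst Bochner_Integration.integral_sum, (intro all_moments_integrable all_moments_intros finite_measure_hatQ all_moments_herm_prod_hatQ))+
      simp
  also have "\<dots> = (\<Sum>\<alpha>\<in>?A. \<Sum>\<beta>\<in>?A. if \<alpha> = \<beta> then (c \<alpha>)\<^sup>2 * (\<Prod>v\<in>vars n. fact (\<alpha> v)) else 0)"
    by (intro sum.cong refl) (simp add: integral_herm_prod_mult power2_eq_square)
  also have "\<dots> = (\<Sum>\<alpha>\<in>?A. (c \<alpha>)\<^sup>2 * (\<Prod>v\<in>vars n. fact (\<alpha> v)))"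
    by (simp add: finite_exps_le)
  finally show ?thesis .
qed

section \<open>The planted law and its Hermite coefficients\<close>

definition signal :: "nat \<Rightarrow> real \<Rightarrow> real \<Rightarrow> (nat \<Rightarrow> real \<times> real) \<Rightarrow> entry \<Rightarrow> real" where
  "signal n lam mu w = case_sum
     (\<lambda>(i, j). lam / sqrt (2 * real n) * (fst (w i) * fst (w j)))
     (\<lambda>(i, j). mu / sqrt (2 * real n) * (snd (w i) * snd (w j)))"

lemma integral_shifted_herm_prod:
  "(\<integral>XY. (\<Prod>v\<in>vars n. poly (hermite (\<alpha> v)) (s v + coord XY v)) \<partial>hatQ n) = (\<Prod>v\<in>vars n. s v ^ \<alpha> v)"
proof -
  have "all_moments std_normal (\<lambda>x. poly (hermite k) (t + x))" for k t
  proof -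
    have "(\<lambda>x. poly (hermite k) (t + x)) = poly (pcompose (hermite k) [:t, 1:])"
      by (rule ext) (simp add: poly_pcompose)
    then show ?thesis by (simp only: all_moments_poly)
  qed
  then show ?thesis
    by (subst integral_hatQ_prod[where \<phi> = "\<lambda>v x. poly (hermite (\<alpha> v)) (s v + x)"]) (auto simp: integral_hermite_shift)
qed

text \<open>Collects what the Hermite expansion and the replica identities rest on. The sub-Gaussian
  law introduced further on is shown to be an instance.\<close>

locale moment_law = prob_space pistar for pistar :: "(real \<times> real) measure" +
  assumes sets_pistar [measurable_cong]: "sets pistar = sets borel"
    and moments_fst: "all_moments pistar fst"
    and moments_snd: "all_moments pistar snd"
begin

definition sample :: "nat \<Rightarrow> (nat \<Rightarrow> real \<times> real) measure" where
  "sample n = (\<Pi>\<^sub>M i\<in>{1..n}. pistar)"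

lemma prob_space_sample: "prob_space (sample n)"
  unfolding sample_def by (intro prob_space_PiM_const prob_space_axioms)

lemma finite_measure_sample: "finite_measure (sample n)"
  by (rule prob_space.finite_measure[OF prob_space_sample])

lemma all_moments_sample:
  "i \<in> {1..n} \<Longrightarrow> all_moments pistar f \<Longrightarrow> all_moments (sample n) (\<lambda>w. f (w i))"
  unfolding sample_def by (intro all_moments_PiM_component prob_space_axioms)

lemma all_moments_signal:
  assumes "v \<in> vars n"
  shows "all_moments (sample n) (\<lambda>w. signal n lam mu w v)"
proof -
  obtain i j where ij: "i \<in> {1..n}" "j \<in> {1..n}" "v = Inl (i, j) \<or> v = Inr (i, j)"
    using assms by (auto simp: vars_def idx_def)
  note m = all_moments_sample[OF _ moments_fst] all_moments_sample[OF _ moments_snd]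
  from ij(3) show ?thesis
    by (elim disjE; simp add: signal_def)
      (intro all_moments_intros finite_measure_sample m ij)+
qed

lemma measurable_spiked:
  "(\<lambda>(w, W, Z). (spiked n lam (\<lambda>i. fst (w i)) W, spiked n mu (\<lambda>i. snd (w i)) Z))
    \<in> (sample n \<Otimes>\<^sub>M hatQ n) \<rightarrow>\<^sub>M (mat_space n \<Otimes>\<^sub>M mat_space n)"
proof -
  have w: "(\<lambda>w. w i) \<in> sample n \<rightarrow>\<^sub>M borel" if "i \<in> {1..n}" for i
    using measurable_component_singleton[OF that, of "\<lambda>_. pistar"]
    by (simp add: sample_def measurable_cong_sets[OF refl sets_pistar])
  have W: "(\<lambda>W. W ij) \<in> mat_space n \<rightarrow>\<^sub>M borel" if "ij \<in> idx n" for ij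
    unfolding mat_space_def by (rule measurable_component_singleton[OF that])
  have s: "(\<lambda>z. spiked n l (\<lambda>i. p (fst z i)) (f (snd z))) \<in> (sample n \<Otimes>\<^sub>M hatQ n) \<rightarrow>\<^sub>M mat_space n"
    if p: "p \<in> borel_measurable borel" and f: "f \<in> hatQ n \<rightarrow>\<^sub>M mat_space n" for f l p
    unfolding spiked_def mat_space_def
  proof (rule measurable_restrict)
    fix ij assume ij: "ij \<in> idx n"
    obtain i j where eq: "ij = (i, j)" by force
    have i: "i \<in> {1..n}" and j: "j \<in> {1..n}" using ij by (auto simp: idx_def eq)
    note c = measurable_compose[OF measurable_compose[OF measurable_fst w] p]
      measurable_compose[OF measurable_compose[OF measurable_snd f] W]
    show "(\<lambda>z. case ij of (i, j) \<Rightarrow> l / sqrt (2 * real n) * (p (fst z i) * p (fst z j)) + f (snd z) (i, j))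
        \<in> borel_measurable (sample n \<Otimes>\<^sub>M hatQ n)"
      unfolding eq split
      by (intro borel_measurable_add borel_measurable_times borel_measurable_const c i j ij[unfolded eq])
  qed
  have "fst \<in> hatQ n \<rightarrow>\<^sub>M mat_space n" "snd \<in> hatQ n \<rightarrow>\<^sub>M mat_space n" by measurable
  moreover have "fst \<in> borel_measurable (borel :: (real \<times> real) measure)"
    "snd \<in> borel_measurable (borel :: (real \<times> real) measure)"
    by (intro borel_measurable_continuous_onI continuous_intros)+
  ultimately show ?thesis
    unfolding case_prod_beta' by (intro measurable_Pair s)
qed

lemma coord_spiked:
  assumes "v \<in> vars n"
  shows "coord (spiked n lam (\<lambda>i. fst (w i)) (fst XY), spiked n mu (\<lambda>i. snd (w i)) (snd XY)) v
    = signal n lam mu w v + coord XY v"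
  using assms by (auto simp: vars_def coord_def spiked_def signal_def)

lemma all_moments_hatP_coord:
  assumes "v \<in> vars n"
  shows "all_moments (hatP lam mu pistar n) (\<lambda>XY. coord XY v)"
proof -
  let ?T = "\<lambda>(w, W, Z). (spiked n lam (\<lambda>i. fst (w i)) W, spiked n mu (\<lambda>i. snd (w i)) Z)"
  let ?S = "sample n \<Otimes>\<^sub>M hatQ n"
  have "all_moments ?S (\<lambda>z. signal n lam mu (fst z) v + coord (snd z) v)"
    by (intro all_moments_intros all_moments_fst all_moments_snd all_moments_signal all_moments_hatQ_coord
        all_moments_std_normal prob_space_hatQ prob_space_sample assms)
  then have "all_moments ?S (\<lambda>z. coord (?T z) v)"
    using coord_spiked[OF assms] by (simp add: case_prod_beta')
  moreover have [measurable]: "(\<lambda>XY. coord XY v) \<in> borel_measurable (mat_space n \<Otimes>\<^sub>M mat_space n)"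
    using all_moments_measurable[OF all_moments_hatQ_coord[OF assms all_moments_std_normal]]
    by (simp add: measurable_cong_sets[OF sets_hatQ refl])
  ultimately show ?thesis
    using measurable_spiked[of n lam mu] unfolding hatP_def sample_def[symmetric] all_moments_def
    by (auto simp: integrable_distr_eq)
qed

lemma prob_space_hatP: "prob_space (hatP lam mu pistar n)"
  unfolding hatP_def sample_def[symmetric]
  by (intro prob_space.prob_space_distr prob_space_pair prob_space_sample prob_space_hatQ measurable_spiked)

lemma all_moments_lincomb_hatP:
  assumes "lincomb A (herm_prod n) g"
  shows "all_moments (hatP lam mu pistar n) g"
proof -
  obtain c where "g = (\<lambda>XY. \<Sum>a\<in>A. c a * herm_prod n a XY)" using assms unfolding lincomb_def by blast
  moreover have "finite_measure (hatP lam mu pistar n)" by (rule prob_space.finite_measure[OF prob_space_hatP])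
  ultimately show ?thesis unfolding herm_prod_def poly_altdef
    by (simp only:) (intro all_moments_intros all_moments_hatP_coord)
qed

text \<open>Given the sample, each entry is a standard normal variable translated by
  \<open>signal\<close>. Integrating the noise first, the translation identity turns each Hermite
  factor into a power of the signal.\<close>

lemma mean_hatP_herm_prod:
  "mean (hatP lam mu pistar n) (herm_prod n \<alpha>) = (\<integral>w. (\<Prod>v\<in>vars n. signal n lam mu w v ^ \<alpha> v) \<partial>sample n)"
proof -
  let ?T = "\<lambda>(w, W, Z). (spiked n lam (\<lambda>i. fst (w i)) W, spiked n mu (\<lambda>i. snd (w i)) Z)"
  let ?S = "sample n \<Otimes>\<^sub>M hatQ n"
  let ?h = "\<lambda>z. \<Prod>v\<in>vars n. poly (hermite (\<alpha> v)) (signal n lam mu (fst z) v + coord (snd z) v)"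
  interpret S: prob_space "sample n" by (rule prob_space_sample)
  interpret Q: prob_space "hatQ n" by (rule prob_space_hatQ)
  interpret SQ: pair_prob_space "sample n" "hatQ n" ..
  have [measurable]: "herm_prod n \<alpha> \<in> borel_measurable (mat_space n \<Otimes>\<^sub>M mat_space n)"
    using all_moments_measurable[OF all_moments_herm_prod_hatQ]
    by (simp add: measurable_cong_sets[OF sets_hatQ refl])
  have fin: "finite_measure ?S"
    by (rule prob_space.finite_measure[OF prob_space_pair[OF prob_space_sample prob_space_hatQ]])
  have "mean (hatP lam mu pistar n) (herm_prod n \<alpha>) = (\<integral>z. herm_prod n \<alpha> (?T z) \<partial>?S)"
    unfolding mean_def hatP_def sample_def[symmetric]
    by (rule integral_distr[OF measurable_spiked]) measurable
  also have "\<dots> = (\<integral>z. ?h z \<partial>?S)"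
    by (intro Bochner_Integration.integral_cong refl) (simp add: herm_prod_def coord_spiked case_prod_beta')
  also have "\<dots> = (\<integral>w. (\<integral>XY. ?h (w, XY) \<partial>hatQ n) \<partial>sample n)"
  proof (rule SQ.integral_fst'[symmetric])
    show "integrable ?S ?h" unfolding poly_altdef
      by (intro all_moments_integrable all_moments_intros fin all_moments_fst all_moments_snd all_moments_signal
        all_moments_hatQ_coord all_moments_std_normal prob_space_hatQ prob_space_sample)
  qed
  also have "\<dots> = (\<integral>w. (\<Prod>v\<in>vars n. signal n lam mu w v ^ \<alpha> v) \<partial>sample n)"
    by (simp add: integral_shifted_herm_prod)
  finally show ?thesis .
qed

end

subsection \<open>Moments of sums of independent variables\<close>

text \<open>One term of the exponential series gives \<open>r ^ m \<le> exp r * fact m\<close>, and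
  \<open>fact m \<le> m ^ m \<le> M ^ m\<close>.\<close>

lemma power_le_exp_times_power:
  fixes r :: real
  assumes "r \<ge> 0" "m \<le> M"
  shows "r ^ m \<le> exp r * real M ^ m"
proof -
  have "r ^ m / fact m \<le> exp r"
  proof -
    have "(\<Sum>k\<in>{m}. inverse (fact k) *\<^sub>R r ^ k) \<le> suminf (\<lambda>k. inverse (fact k) *\<^sub>R r ^ k)"
      using assms by (intro sum_le_suminf summable_exp_generic) auto
    then show ?thesis by (simp add: exp_def divide_inverse mult.commute)
  qed
  then have "r ^ m \<le> exp r * fact m" by (simp add: divide_le_eq)
  also have "fact m \<le> real M ^ m"
    using fact_le_power[of m] power_mono[OF assms(2), of m]
    by (metis of_nat_fact of_nat_le_iff of_nat_power order_trans zero_le)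
  finally show ?thesis by simp
qed

lemma cubic_tail_sum_le:
  fixes \<eta> :: real
  assumes "0 \<le> \<eta>" "\<eta> \<le> 1 / 2"
  shows "(\<Sum>k=3..m. \<eta> ^ k) \<le> 2 * \<eta> ^ 3"
proof -
  have s: "summable (\<lambda>k. \<eta> ^ 3 * \<eta> ^ k)"
    using assms by (intro summable_mult summable_geometric) auto
  have "(\<Sum>k=3..m. \<eta> ^ k) \<le> (\<Sum>k<Suc m. \<eta> ^ 3 * \<eta> ^ k)"
    unfolding power_add[symmetric] using assms
  proof (intro sum_le_included[where i = "\<lambda>k. k + 3"] ballI)
    fix x assume "x \<in> {3..m}"
    then show "\<exists>y\<in>{..<Suc m}. y + 3 = x \<and> \<eta> ^ x \<le> \<eta> ^ (3 + y)"
      by (intro bexI[of _ "x - 3"]) auto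
  qed auto
  also have "\<dots> \<le> suminf (\<lambda>k. \<eta> ^ 3 * \<eta> ^ k)"
    using assms by (intro sum_le_suminf s) auto
  also have "\<dots> = \<eta> ^ 3 / (1 - \<eta>)"
    using assms by (subst suminf_mult) (auto simp: suminf_geometric intro: summable_geometric)
  also have "\<dots> \<le> \<eta> ^ 3 * 2"
    using assms mult_left_mono[of "1" "2 * (1 - \<eta>)" "\<eta> ^ 3"] by (simp add: divide_le_eq algebra_simps)
  finally show ?thesis by simp
qed

text \<open>For independent centred \<open>X\<^sub>1, \<dots>, X\<^sub>n\<close> with \<open>\<beta> k = E X\<^sup>k / k!\<close>, the inner sum is
  \<open>E (X\<^sub>1 + \<dots> + X\<^sub>n)\<^sup>p / p!\<close>. Since the degree is at most \<open>M\<close>, every power of \<open>r\<close> can be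
  traded for \<open>exp r\<close> times the same power of \<open>M\<close>; afterwards the sum factorises.\<close>

lemma sum_multi_exps_moments_le:
  fixes \<beta> :: "nat \<Rightarrow> real"
  assumes fin: "finite I" and \<beta>: "\<beta> 0 = 1" "\<beta> 1 = 0" "\<beta> 2 = \<tau>"
    and tail: "\<And>k. k \<ge> 3 \<Longrightarrow> \<bar>\<beta> k\<bar> \<le> (\<theta> * r) ^ k"
    and nn: "\<tau> \<ge> 0" "\<theta> \<ge> 0" "r \<ge> 0" and small: "real M * \<theta> \<le> 1 / 2"
  shows "(\<Sum>p\<le>M. \<bar>\<Sum>\<kappa>\<in>multi_exps I p. \<Prod>i\<in>I. \<beta> (\<kappa> i)\<bar>)
    \<le> exp (r + real (card I) * (\<tau> + 2 * (real M * \<theta>) ^ 3))"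
proof -
  \<comment> \<open>\<open>e\<close> keeps only the exponents that are at least 3, where the bound
    on \<open>\<beta>\<close> carries powers of \<open>r\<close>. Orders 1 and 2 are kept exactly,
    so that the variance term \<open>\<tau>\<close> enters without loss; \<open>c\<close> is the
    bound after \<open>r\<close> has been traded for \<open>M\<close>.\<close>
  define e where "e = (\<lambda>k::nat. if k \<ge> 3 then k else 0)"
  define d where "d = (\<lambda>k::nat. if k \<ge> 3 then \<theta> ^ k else \<bar>\<beta> k\<bar>)"
  define c where "c = (\<lambda>k. d k * real M ^ e k)"
  have d0: "d k \<ge> 0" for k using nn by (simp add: d_def)
  have c0: "c k \<ge> 0" for k using d0 by (simp add: c_def)
  have \<beta>_le: "\<bar>\<beta> k\<bar> \<le> d k * r ^ e k" for k
    using tail[of k] by (simp add: d_def e_def power_mult_distrib)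
  have summand: "\<bar>\<Prod>i\<in>I. \<beta> (\<kappa> i)\<bar> \<le> exp r * (\<Prod>i\<in>I. c (\<kappa> i))" if "\<kappa> \<in> multi_exps I p" "p \<le> M" for \<kappa> p
  proof -
    have "(\<Sum>i\<in>I. e (\<kappa> i)) \<le> sum \<kappa> I" by (intro sum_mono) (simp add: e_def)
    then have le: "(\<Sum>i\<in>I. e (\<kappa> i)) \<le> M" using that by (simp add: multi_exps_def)
    have "\<bar>\<Prod>i\<in>I. \<beta> (\<kappa> i)\<bar> \<le> (\<Prod>i\<in>I. d (\<kappa> i) * r ^ e (\<kappa> i))"
      unfolding abs_prod by (intro prod_mono) (auto simp: \<beta>_le)
    also have "\<dots> = (\<Prod>i\<in>I. d (\<kappa> i)) * r ^ (\<Sum>i\<in>I. e (\<kappa> i))"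
      by (simp add: prod.distrib power_sum)
    also have "\<dots> \<le> (\<Prod>i\<in>I. d (\<kappa> i)) * (exp r * real M ^ (\<Sum>i\<in>I. e (\<kappa> i)))"
      using le nn d0 by (intro mult_left_mono power_le_exp_times_power prod_nonneg) auto
    also have "\<dots> = exp r * (\<Prod>i\<in>I. c (\<kappa> i))"
      by (simp add: c_def prod.distrib power_sum)
    finally show ?thesis .
  qed
  have "(\<Sum>p\<le>M. \<bar>\<Sum>\<kappa>\<in>multi_exps I p. \<Prod>i\<in>I. \<beta> (\<kappa> i)\<bar>)
      \<le> (\<Sum>p\<le>M. \<Sum>\<kappa>\<in>multi_exps I p. exp r * (\<Prod>i\<in>I. c (\<kappa> i)))"
    by (intro sum_mono order_trans[OF sum_abs] sum_mono summand) auto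
  also have "\<dots> = exp r * (\<Sum>p\<le>M. \<Sum>\<kappa>\<in>multi_exps I p. \<Prod>i\<in>I. c (\<kappa> i))"
    by (simp add: sum_distrib_left)
  also have "\<dots> \<le> exp r * (\<Sum>k\<le>M. c k) ^ card I"
    by (intro mult_left_mono sum_multi_exps_prod_le fin c0) auto
  also have "(\<Sum>k\<le>M. c k) \<le> 1 + (\<tau> + 2 * (real M * \<theta>) ^ 3)"
  proof -
    have "(\<Sum>k\<le>M. c k) \<le> (\<Sum>k\<in>{0, 1, 2} \<union> {3..M}. c k)"
      using c0 by (intro sum_mono2) auto
    also have "\<dots> = (\<Sum>k\<in>{0, 1, 2}. c k) + (\<Sum>k\<in>{3..M}. c k)"
      by (rule sum.union_disjoint) auto
    also have "(\<Sum>k\<in>{0, 1, 2}. c k) = 1 + \<tau>"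
      using \<beta> nn by (simp add: c_def d_def e_def numeral_2_eq_2)
    also have "(\<Sum>k\<in>{3..M}. c k) = (\<Sum>k=3..M. (real M * \<theta>) ^ k)"
      by (intro sum.cong) (auto simp: c_def d_def e_def power_mult_distrib mult.commute)
    also have "\<dots> \<le> 2 * (real M * \<theta>) ^ 3"
      using nn small by (intro cubic_tail_sum_le) auto
    finally show ?thesis by simp
  qed
  \<comment> \<open>This is \<open>1 + x \<le> exp x\<close>, raised to the number of
    summands.\<close>
  then have "exp r * (\<Sum>k\<le>M. c k) ^ card I \<le> exp r * exp (\<tau> + 2 * (real M * \<theta>) ^ 3) ^ card I"
    using c0 exp_ge_add_one_self[of "\<tau> + 2 * (real M * \<theta>) ^ 3"]
    by (intro mult_left_mono power_mono sum_nonneg) (auto intro: order_trans)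
  also have "\<dots> = exp (r + real (card I) * (\<tau> + 2 * (real M * \<theta>) ^ 3))"
    by (simp add: exp_add exp_of_nat_mult)
  finally show ?thesis .
qed

subsection \<open>Replicas and overlaps\<close>

text \<open>In the binomial expansion the odd Gaussian moments vanish, and the even moments, divided
  by factorials, are the terms of a binomial expansion in \<open>a\<^sup>2 / 2\<close> and
  \<open>b\<^sup>2 / 2\<close>.\<close>

lemma std_normal_square_moment:
  "(\<integral>\<gamma>. (a * fst \<gamma> + b * snd \<gamma>) ^ (2 * d) \<partial>(std_normal \<Otimes>\<^sub>M std_normal)) / fact (2 * d)
    = ((a\<^sup>2 + b\<^sup>2) / 2) ^ d / fact d"
proof -
  define m where "m = (\<lambda>k. (\<integral>x. x ^ k \<partial>std_normal) / fact k)"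
  have m_even: "m (2 * k) = 1 / (2 ^ k * fact k)" for k
    by (simp add: m_def std_normal_even_moment)
  have m_odd: "m k = 0" if "odd k" for k
    using that by (simp add: m_def std_normal_odd_moment)
  let ?G = "std_normal \<Otimes>\<^sub>M std_normal"
  have fin: "finite_measure ?G"
    by (intro prob_space.finite_measure prob_space_pair prob_space_std_normal)
  note am = all_moments_intros fin finite_measure_std_normal all_moments_fst all_moments_snd
    all_moments_std_normal prob_space_std_normal
  have prod: "(\<integral>\<gamma>. fst \<gamma> ^ i * snd \<gamma> ^ j \<partial>?G) = (\<integral>x. x ^ i \<partial>std_normal) * (\<integral>x. x ^ j \<partial>std_normal)" for i j
    by (rule integral_pair_mult[where f = "\<lambda>x. x ^ i" and g = "\<lambda>x. x ^ j"]) (intro am)+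
  have "(\<integral>\<gamma>. (a * fst \<gamma> + b * snd \<gamma>) ^ (2 * d) \<partial>?G) / fact (2 * d)
      = (\<integral>\<gamma>. (\<Sum>k\<le>2 * d. (a ^ k * b ^ (2 * d - k) / (fact k * fact (2 * d - k))) * (fst \<gamma> ^ k * snd \<gamma> ^ (2 * d - k))) \<partial>?G)"
    unfolding binomial_ring Bochner_Integration.integral_divide_zero[symmetric] sum_divide_distrib
    by (intro Bochner_Integration.integral_cong refl sum.cong)
      (auto simp: binomial_fact power_mult_distrib field_simps)
  also have "\<dots> = (\<Sum>k\<le>2 * d. (a ^ k * b ^ (2 * d - k) / (fact k * fact (2 * d - k))) *
      ((\<integral>x. x ^ k \<partial>std_normal) * (\<integral>x. x ^ (2 * d - k) \<partial>std_normal)))"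
    by (subst Bochner_Integration.integral_sum, (intro all_moments_integrable am)) (simp add: prod)
  also have "\<dots> = (\<Sum>k\<le>2 * d. a ^ k * m k * (b ^ (2 * d - k) * m (2 * d - k)))"
    by (intro sum.cong refl) (simp add: m_def)
  also have "\<dots> = (\<Sum>k\<in>(\<lambda>j. 2 * j) ` {..d}. a ^ k * m k * (b ^ (2 * d - k) * m (2 * d - k)))"
  proof (rule sum.mono_neutral_right)
    show "\<forall>k\<in>{..2 * d} - (\<lambda>j. 2 * j) ` {..d}. a ^ k * m k * (b ^ (2 * d - k) * m (2 * d - k)) = 0"
    proof
      fix k assume "k \<in> {..2 * d} - (\<lambda>j. 2 * j) ` {..d}"
      then have "odd k" by (auto elim!: evenE)
      then show "a ^ k * m k * (b ^ (2 * d - k) * m (2 * d - k)) = 0" by (simp add: m_odd)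
    qed
  qed auto
  also have "\<dots> = (\<Sum>j\<le>d. a ^ (2 * j) * m (2 * j) * (b ^ (2 * d - 2 * j) * m (2 * d - 2 * j)))"
    by (subst sum.reindex) (auto simp: inj_on_def)
  also have "\<dots> = (\<Sum>j\<le>d. (a\<^sup>2 / 2) ^ j / fact j * ((b\<^sup>2 / 2) ^ (d - j) / fact (d - j)))"
  proof (intro sum.cong refl)
    fix j
    have "2 * d - 2 * j = 2 * (d - j)" by simp
    then show "a ^ (2 * j) * m (2 * j) * (b ^ (2 * d - 2 * j) * m (2 * d - 2 * j))
        = (a\<^sup>2 / 2) ^ j / fact j * ((b\<^sup>2 / 2) ^ (d - j) / fact (d - j))"
      by (simp only: m_even) (simp add: power_divide power_mult)
  qed
  also have "\<dots> = (\<Sum>j\<le>d. of_nat (d choose j) * (a\<^sup>2 / 2) ^ j * (b\<^sup>2 / 2) ^ (d - j)) / fact d"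
    unfolding sum_divide_distrib
    by (intro sum.cong refl) (auto simp: binomial_fact field_simps)
  also have "\<dots> = ((a\<^sup>2 + b\<^sup>2) / 2) ^ d / fact d"
    by (simp add: binomial_ring[symmetric] add_divide_distrib)
  finally show ?thesis .
qed

context moment_law
begin

text \<open>Cauchy-Schwarz on the coefficients, weighted by \<open>sqrt (\<alpha>!)\<close>; the
  first factor is then the second moment under \<open>hatQ\<close> by Parseval.\<close>

lemma mean_hatP_square_le:
  assumes "lincomb (exps_le n D) (herm_prod n) g"
  shows "(mean (hatP lam mu pistar n) g)\<^sup>2 \<le> mean (hatQ n) (\<lambda>XY. (g XY)\<^sup>2) *
    (\<Sum>\<alpha>\<in>exps_le n D. (\<integral>w. (\<Prod>v\<in>vars n. signal n lam mu w v ^ \<alpha> v) \<partial>sample n)\<^sup>2 / (\<Prod>v\<in>vars n. fact (\<alpha> v)))"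
proof -
  let ?A = "exps_le n D" and ?f = "\<lambda>\<alpha>. \<Prod>v\<in>vars n. fact (\<alpha> v) :: real"
  let ?e = "\<lambda>\<alpha>. \<integral>w. (\<Prod>v\<in>vars n. signal n lam mu w v ^ \<alpha> v) \<partial>sample n"
  obtain c where g: "g = (\<lambda>XY. \<Sum>\<alpha>\<in>?A. c \<alpha> * herm_prod n \<alpha> XY)" using assms unfolding lincomb_def by blast
  have pos: "?f \<alpha> > 0" for \<alpha> by (intro prod_pos) simp
  have "all_moments (hatP lam mu pistar n) (herm_prod n \<alpha>)" if "\<alpha> \<in> ?A" for \<alpha>
    using that by (intro all_moments_lincomb_hatP[of ?A] lincomb_base finite_exps_le)
  then have "mean (hatP lam mu pistar n) g = (\<Sum>\<alpha>\<in>?A. c \<alpha> * mean (hatP lam mu pistar n) (herm_prod n \<alpha>))"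
    unfolding g mean_def
    by (subst Bochner_Integration.integral_sum) (auto intro!: all_moments_integrable integrable_mult_right)
  also have "\<dots> = (\<Sum>\<alpha>\<in>?A. (c \<alpha> * sqrt (?f \<alpha>)) * (?e \<alpha> / sqrt (?f \<alpha>)))"
    using pos by (intro sum.cong refl) (simp add: mean_hatP_herm_prod less_imp_neq[OF pos, symmetric])
  finally have "(mean (hatP lam mu pistar n) g)\<^sup>2 \<le>
      (\<Sum>\<alpha>\<in>?A. (c \<alpha> * sqrt (?f \<alpha>))\<^sup>2) * (\<Sum>\<alpha>\<in>?A. (?e \<alpha> / sqrt (?f \<alpha>))\<^sup>2)"
    by (simp only: Cauchy_Schwarz_ineq_sum)
  also have "(\<Sum>\<alpha>\<in>?A. (c \<alpha> * sqrt (?f \<alpha>))\<^sup>2) = mean (hatQ n) (\<lambda>XY. (g XY)\<^sup>2)"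
    using less_imp_le[OF pos] by (simp add: mean_def g integral_lincomb_square power_mult_distrib)
  also have "(\<Sum>\<alpha>\<in>?A. (?e \<alpha> / sqrt (?f \<alpha>))\<^sup>2) = (\<Sum>\<alpha>\<in>?A. (?e \<alpha>)\<^sup>2 / ?f \<alpha>)"
    using less_imp_le[OF pos] by (simp add: power_divide)
  finally show ?thesis .
qed

definition replicas :: "nat \<Rightarrow> ((nat \<Rightarrow> real \<times> real) \<times> (nat \<Rightarrow> real \<times> real)) measure" where
  "replicas n = sample n \<Otimes>\<^sub>M sample n"

lemma prob_space_replicas: "prob_space (replicas n)"
  unfolding replicas_def by (intro prob_space_pair prob_space_sample)

lemma finite_measure_replicas: "finite_measure (replicas n)"
  by (rule prob_space.finite_measure[OF prob_space_replicas])

text \<open>Central limit scaling: the overlap of two replicas is divided by \<open>sqrt n\<close>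
  rather than by \<open>n\<close>.\<close>

definition overlap :: "nat \<Rightarrow> (real \<times> real \<Rightarrow> real) \<Rightarrow> (nat \<Rightarrow> real \<times> real) \<times> (nat \<Rightarrow> real \<times> real) \<Rightarrow> real" where
  "overlap n p z = (\<Sum>i\<in>{1..n}. p (fst z i) * p (snd z i)) / sqrt (real n)"

lemma all_moments_replicas:
  assumes "i \<in> {1..n}" "all_moments pistar p"
  shows "all_moments (replicas n) (\<lambda>z. p (fst z i))" "all_moments (replicas n) (\<lambda>z. p (snd z i))"
  unfolding replicas_def
  using all_moments_fst[OF prob_space_sample all_moments_sample[OF assms]]
    all_moments_snd[OF prob_space_sample prob_space_sample all_moments_sample[OF assms]] by simp_all

lemma all_moments_overlap:
  assumes "all_moments pistar p"
  shows "all_moments (replicas n) (overlap n p)"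
  unfolding overlap_def
  by (intro all_moments_intros finite_measure_replicas all_moments_replicas assms)

lemma sum_idx_products: "(\<Sum>(i, j)\<in>idx n. f i * f j :: real) = (\<Sum>i\<in>{1..n}. f i)\<^sup>2"
  unfolding idx_def by (simp add: sum.cartesian_product[symmetric] power2_eq_square sum_product)

text \<open>The rank-one structure makes the double sum over entries a perfect square. Of the factor
  \<open>1 / (2 n)\<close> from the two spikes, \<open>1 / n\<close> is absorbed by the squared
  overlap.\<close>

lemma sum_signal_mult:
  "(\<Sum>v\<in>vars n. signal n lam mu (fst z) v * signal n lam mu (snd z) v) =
    ((lam * overlap n fst z)\<^sup>2 + (mu * overlap n snd z)\<^sup>2) / 2"
proof -
  have sq: "(\<Sum>ij\<in>idx n. (case ij of (i, j) \<Rightarrow> l / sqrt (2 * real n) * (p (fst z i) * p (fst z j))) *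
      (case ij of (i, j) \<Rightarrow> l / sqrt (2 * real n) * (p (snd z i) * p (snd z j)))) = (l * overlap n p z)\<^sup>2 / 2"
    for l :: real and p :: "real \<times> real \<Rightarrow> real"
  proof -
    have "(\<Sum>ij\<in>idx n. (case ij of (i, j) \<Rightarrow> l / sqrt (2 * real n) * (p (fst z i) * p (fst z j))) *
      (case ij of (i, j) \<Rightarrow> l / sqrt (2 * real n) * (p (snd z i) * p (snd z j))))
      = (\<Sum>(i, j)\<in>idx n. l\<^sup>2 / (2 * real n) * ((p (fst z i) * p (snd z i)) * (p (fst z j) * p (snd z j))))"
      by (intro sum.cong refl) (auto simp: field_simps power2_eq_square)
    also have "\<dots> = l\<^sup>2 / (2 * real n) * (\<Sum>i\<in>{1..n}. p (fst z i) * p (snd z i))\<^sup>2"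
      unfolding sum_idx_products[symmetric] by (simp add: sum_distrib_left case_prod_beta')
    also have "\<dots> = (l * overlap n p z)\<^sup>2 / 2"
      by (simp add: overlap_def power_mult_distrib power_divide)
    finally show ?thesis .
  qed
  have Inl: "signal n lam mu w (Inl ij) = (case ij of (i, j) \<Rightarrow> lam / sqrt (2 * real n) * (fst (w i) * fst (w j)))"
    and Inr: "signal n lam mu w (Inr ij) = (case ij of (i, j) \<Rightarrow> mu / sqrt (2 * real n) * (snd (w i) * snd (w j)))"
    for w ij by (simp_all add: signal_def)
  show ?thesis
    unfolding vars_def sum.Plus[OF finite_idx finite_idx] o_def Inl Inr sq add_divide_distrib by (rule refl)
qed

text \<open>A squared expectation is an expectation over two independent copies. For each total
  degree the multinomial theorem then sums the products over all exponents.\<close>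

lemma sum_signal_moments:
  "(\<Sum>\<alpha>\<in>exps_le n D. (\<integral>w. (\<Prod>v\<in>vars n. signal n lam mu w v ^ \<alpha> v) \<partial>sample n)\<^sup>2 / (\<Prod>v\<in>vars n. fact (\<alpha> v)))
    = (\<integral>z. (\<Sum>d\<le>D. (((lam * overlap n fst z)\<^sup>2 + (mu * overlap n snd z)\<^sup>2) / 2) ^ d / fact d) \<partial>replicas n)"
proof -
  let ?u = "\<lambda>z v. signal n lam mu (fst z) v * signal n lam mu (snd z) v"
  let ?s = "\<lambda>\<alpha> w. \<Prod>v\<in>vars n. signal n lam mu w v ^ \<alpha> v"
  have am: "all_moments (sample n) (?s \<alpha>)" for \<alpha>
    by (intro all_moments_intros finite_measure_sample all_moments_signal)
  have amz: "all_moments (replicas n) (\<lambda>z. \<Prod>v\<in>vars n. ?u z v ^ \<alpha> v / fact (\<alpha> v))" for \<alpha>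
    by (intro all_moments_intros finite_measure_replicas)
      (auto simp: replicas_def intro!: all_moments_fst all_moments_snd prob_space_sample all_moments_signal)
  have "(\<Sum>\<alpha>\<in>exps_le n D. (\<integral>w. ?s \<alpha> w \<partial>sample n)\<^sup>2 / (\<Prod>v\<in>vars n. fact (\<alpha> v)))
      = (\<Sum>\<alpha>\<in>exps_le n D. \<integral>z. (\<Prod>v\<in>vars n. ?u z v ^ \<alpha> v / fact (\<alpha> v)) \<partial>replicas n)"
  proof (intro sum.cong refl)
    fix \<alpha>
    have "(\<integral>w. ?s \<alpha> w \<partial>sample n)\<^sup>2 = (\<integral>z. ?s \<alpha> (fst z) * ?s \<alpha> (snd z) \<partial>replicas n)"
      unfolding replicas_def power2_eq_square
      by (rule integral_pair_mult[symmetric]) (intro am prob_space_sample)+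
    then show "(\<integral>w. ?s \<alpha> w \<partial>sample n)\<^sup>2 / (\<Prod>v\<in>vars n. fact (\<alpha> v)) =
        (\<integral>z. (\<Prod>v\<in>vars n. ?u z v ^ \<alpha> v / fact (\<alpha> v)) \<partial>replicas n)"
      by (simp add: prod_dividef prod.distrib power_mult_distrib)
  qed
  also have "\<dots> = (\<integral>z. (\<Sum>\<alpha>\<in>exps_le n D. \<Prod>v\<in>vars n. ?u z v ^ \<alpha> v / fact (\<alpha> v)) \<partial>replicas n)"
    by (rule Bochner_Integration.integral_sum[symmetric]) (intro all_moments_integrable amz)
  also have "\<dots> = (\<integral>z. (\<Sum>d\<le>D. sum (?u z) (vars n) ^ d / fact d) \<partial>replicas n)"
  proof (intro Bochner_Integration.integral_cong refl)
    fix z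
    have "(\<Sum>\<alpha>\<in>exps_le n D. \<Prod>v\<in>vars n. ?u z v ^ \<alpha> v / fact (\<alpha> v))
      = (\<Sum>d\<le>D. \<Sum>\<alpha>\<in>multi_exps (vars n) d. \<Prod>v\<in>vars n. ?u z v ^ \<alpha> v / fact (\<alpha> v))"
      unfolding exps_le_def
      by (intro sum.UNION_disjoint) (auto simp: finite_multi_exps finite_vars, auto simp: multi_exps_def)
    then show "(\<Sum>\<alpha>\<in>exps_le n D. \<Prod>v\<in>vars n. ?u z v ^ \<alpha> v / fact (\<alpha> v)) = (\<Sum>d\<le>D. sum (?u z) (vars n) ^ d / fact d)"
      by (simp add: multinomial_theorem finite_vars)
  qed
  finally show ?thesis by (simp only: sum_signal_mult)
qed

text \<open>Averaging \<open>(a g + b h)\<^bsup>2d\<^esup> / (2d)!\<close> over independent standard normals \<open>g, h\<close> gives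
  \<open>((a\<^sup>2 + b\<^sup>2) / 2)\<^bsup>d\<^esup> / d!\<close>, which replaces the quadratic function of the overlaps by a
  linear one.\<close>

lemma integral_overlap_linearised:
  "(\<integral>z. (\<Sum>d\<le>D. (((lam * overlap n fst z)\<^sup>2 + (mu * overlap n snd z)\<^sup>2) / 2) ^ d / fact d) \<partial>replicas n)
    = (\<integral>\<gamma>. (\<Sum>d\<le>D. (\<integral>z. (lam * fst \<gamma> * overlap n fst z + mu * snd \<gamma> * overlap n snd z) ^ (2 * d) \<partial>replicas n)
        / fact (2 * d)) \<partial>(std_normal \<Otimes>\<^sub>M std_normal))"
proof -
  let ?G = "std_normal \<Otimes>\<^sub>M std_normal"
  let ?A = "\<lambda>z. lam * overlap n fst z" and ?B = "\<lambda>z. mu * overlap n snd z"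
  let ?l = "\<lambda>z \<gamma>. (\<Sum>d\<le>D. (?A z * fst \<gamma> + ?B z * snd \<gamma>) ^ (2 * d) / fact (2 * d))"
  interpret R: prob_space "replicas n" by (rule prob_space_replicas)
  interpret G: prob_space ?G by (intro prob_space_pair prob_space_std_normal)
  interpret RG: pair_prob_space "replicas n" ?G ..
  have fin: "finite_measure (replicas n \<Otimes>\<^sub>M ?G)"
    by (intro prob_space.finite_measure prob_space_pair prob_space_replicas prob_space_std_normal)
  note am = all_moments_intros fin finite_measure_std_normal finite_measure_replicas G.finite_measure_axioms
    all_moments_overlap moments_fst moments_snd all_moments_std_normal
    all_moments_fst[OF G.prob_space_axioms] all_moments_snd[OF R.prob_space_axioms G.prob_space_axioms]
    all_moments_fst[OF prob_space_std_normal] all_moments_snd[OF prob_space_std_normal prob_space_std_normal]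
  have "(\<integral>z. (\<Sum>d\<le>D. (((?A z)\<^sup>2 + (?B z)\<^sup>2) / 2) ^ d / fact d) \<partial>replicas n) = (\<integral>z. (\<integral>\<gamma>. ?l z \<gamma> \<partial>?G) \<partial>replicas n)"
    by (intro Bochner_Integration.integral_cong refl, subst Bochner_Integration.integral_sum)
      ((intro all_moments_integrable am), simp add: std_normal_square_moment)
  also have "\<dots> = (\<integral>\<gamma>. (\<integral>z. ?l z \<gamma> \<partial>replicas n) \<partial>?G)"
  \<comment> \<open>The truncated series is a polynomial in variables with all moments, hence
    integrable on the product space.\<close>
  proof (rule RG.Fubini_integral[symmetric])
    have "all_moments (replicas n \<Otimes>\<^sub>M ?G) (\<lambda>x. ?l (fst x) (snd x))"
      by (intro am)
    then show "integrable (replicas n \<Otimes>\<^sub>M ?G) (case_prod ?l)"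
      by (simp add: all_moments_integrable case_prod_beta')
  qed
  also have "\<dots> = (\<integral>\<gamma>. (\<Sum>d\<le>D. (\<integral>z. (lam * fst \<gamma> * overlap n fst z + mu * snd \<gamma> * overlap n snd z) ^ (2 * d) \<partial>replicas n)
        / fact (2 * d)) \<partial>?G)"
    by (intro Bochner_Integration.integral_cong refl, subst Bochner_Integration.integral_sum)
      ((intro all_moments_integrable am), simp add: mult_ac)
  finally show ?thesis .
qed

end

subsection \<open>Sub-Gaussian moments\<close>

text \<open>A single term of the series of \<open>cosh\<close>, all of whose terms are
  nonnegative.\<close>

lemma power_2k_le_cosh:
  fixes t x :: real
  shows "(t * x) ^ (2 * k) / fact (2 * k) \<le> (exp (t * x) + exp (- t * x)) / 2"
proof -
  define f where "f = (\<lambda>n. if even n then (t * x) ^ n /\<^sub>R fact n else 0)"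
  have f: "f sums cosh (t * x)" unfolding f_def by (rule cosh_converges)
  have "0 \<le> f n" for n by (auto simp: f_def intro!: mult_nonneg_nonneg zero_le_even_power)
  then have "sum f {2 * k} \<le> suminf f" using f by (intro sum_le_suminf) (auto simp: sums_iff)
  moreover have "sum f {2 * k} = (t * x) ^ (2 * k) / fact (2 * k)"
    by (simp add: f_def divide_inverse_commute)
  moreover have "suminf f = (exp (t * x) + exp (- t * x)) / 2"
    using sums_unique[OF f] by (simp add: cosh_field_def)
  ultimately show ?thesis by simp
qed

lemma abs_power_square: "(\<bar>x\<bar> ^ k)\<^sup>2 = x ^ (2 * k)" for x :: real
proof -
  have "(\<bar>x\<bar> ^ k)\<^sup>2 = (\<bar>x\<bar>\<^sup>2) ^ k" by (simp only: power_mult[symmetric] mult.commute)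
  then show ?thesis by (simp only: power2_abs power_mult)
qed

locale correlated_subgaussian_law = prob_space pistar for pistar :: "(real \<times> real) measure" +
  fixes rho C' :: real
  assumes sets_pistar': "sets pistar = sets borel"
    and mean_fst: "mean pistar fst = 0" and mean_snd: "mean pistar snd = 0"
    and mean_fst2: "mean pistar (\<lambda>(x, y). x\<^sup>2) = 1" and mean_snd2: "mean pistar (\<lambda>(x, y). y\<^sup>2) = 1"
    and mean_fst_snd: "mean pistar (\<lambda>(x, y). x * y) = rho"
    and subgaussian_fst: "subgaussian pistar C' fst" and subgaussian_snd: "subgaussian pistar C' snd"
begin

text \<open>Growth of order \<open>fact k\<close> for the moment of order \<open>2 * k\<close> is
  what makes the moments of a product of two such variables, once divided by \<open>fact k\<close>,
  grow only geometrically.\<close>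

lemma subgaussian_even_moment:
  assumes X: "X \<in> borel_measurable pistar" "subgaussian pistar C' X"
  shows "integrable pistar (\<lambda>w. X w ^ (2 * k))"
    and "(\<integral>w. X w ^ (2 * k) \<partial>pistar) \<le> fact k * exp (C'\<^sup>2) ^ k"
proof -
  have "integrable pistar (\<lambda>w. X w ^ (2 * k)) \<and> (\<integral>w. X w ^ (2 * k) \<partial>pistar) \<le> fact k * exp (C'\<^sup>2) ^ k"
  proof (cases "k = 0")
    case True
    then show ?thesis by (simp add: prob_space)
  next
    case False
    \<comment> \<open>With \<open>t\<^sup>2 = 2 k\<close> the moment generating function is bounded
      by \<open>exp (C'\<^sup>2) ^ k\<close>, while \<open>t ^ (2 k)\<close> reduces
      \<open>fact (2 k)\<close> to at most \<open>fact k\<close>. The case \<open>k = 0\<close> is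
      separate because division by \<open>t\<close> requires \<open>t > 0\<close>.\<close>
    define t where "t = sqrt (2 * real k)"
    have t: "t > 0" "t\<^sup>2 = 2 * real k" using False by (auto simp: t_def)
    have tk: "t ^ (2 * k) = (2 * real k) ^ k" by (simp only: power_mult t(2))
    let ?b = "\<lambda>w. fact (2 * k) / t ^ (2 * k) * ((exp (t * X w) + exp (- t * X w)) / 2)"
    have int: "integrable pistar (\<lambda>w. exp (s * X w))" "(\<integral>w. exp (s * X w) \<partial>pistar) \<le> exp (C'\<^sup>2 * s\<^sup>2 / 2)" for s
      using X(2) by (auto simp: subgaussian_def)
    have int_b: "integrable pistar ?b" using int[of t] int[of "- t"] by auto
    have le: "X w ^ (2 * k) \<le> ?b w" for w
      using power_2k_le_cosh[of t "X w" k] t(1) by (simp add: power_mult_distrib field_simps)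
    have int_X: "integrable pistar (\<lambda>w. X w ^ (2 * k))"
    proof (rule Bochner_Integration.integrable_bound[OF int_b])
      show "AE w in pistar. norm (X w ^ (2 * k)) \<le> norm (?b w)"
      proof (rule AE_I2)
        fix w
        have "norm (X w ^ (2 * k)) = X w ^ (2 * k)" by (simp add: zero_le_even_power)
        then show "norm (X w ^ (2 * k)) \<le> norm (?b w)"
          using le[of w] abs_ge_self[of "?b w"] unfolding real_norm_def by linarith
      qed
    qed (use X(1) in measurable)
    have "(\<integral>w. X w ^ (2 * k) \<partial>pistar) \<le> (\<integral>w. ?b w \<partial>pistar)"
      by (intro integral_mono int_X int_b le)
    also have "\<dots> = fact (2 * k) / t ^ (2 * k) * (((\<integral>w. exp (t * X w) \<partial>pistar) + (\<integral>w. exp (- t * X w) \<partial>pistar)) / 2)"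
      using int[of t] int[of "- t"] by simp
    also have "\<dots> \<le> fact (2 * k) / t ^ (2 * k) * exp (C'\<^sup>2 * t\<^sup>2 / 2)"
      using int(2)[of t] int(2)[of "- t"] t(1) by (intro mult_left_mono) auto
    also have "exp (C'\<^sup>2 * t\<^sup>2 / 2) = exp (C'\<^sup>2) ^ k"
      by (simp add: t(2) exp_of_nat_mult[symmetric] mult.commute)
    also have "fact (2 * k) / t ^ (2 * k) * exp (C'\<^sup>2) ^ k = fact (2 * k) / (2 * real k) ^ k * exp (C'\<^sup>2) ^ k"
      by (simp only: tk)
    also have "\<dots> \<le> fact k * exp (C'\<^sup>2) ^ k"
    proof -
      \<comment> \<open>The quotient of the factorials is a product of \<open>k\<close> factors,
        each at most \<open>2 k\<close>.\<close>
      have "fact (2 * k) = fact k * (fact (2 * k) div fact k :: nat)"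
        by (rule dvd_mult_div_cancel[symmetric]) (simp add: fact_dvd)
      also have "\<dots> \<le> fact k * (2 * k) ^ k"
        using fact_div_fact_le_pow[of k "2 * k"] by (intro mult_le_mono2) (simp add: mult_2)
      finally have "real (fact (2 * k)) \<le> real (fact k * (2 * k) ^ k)" by (simp only: of_nat_le_iff)
      then have "fact (2 * k) / (2 * real k) ^ k \<le> fact k"
        using False by (simp add: divide_le_eq)
      then show ?thesis by (intro mult_right_mono) auto
    qed
    finally show ?thesis using int_X by blast
  qed
  then show "integrable pistar (\<lambda>w. X w ^ (2 * k))"
    and "(\<integral>w. X w ^ (2 * k) \<partial>pistar) \<le> fact k * exp (C'\<^sup>2) ^ k" by auto
qed

lemma measurable_coords: "fst \<in> borel_measurable pistar" "snd \<in> borel_measurable pistar"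
  unfolding measurable_cong_sets[OF sets_pistar' refl]
  by (intro borel_measurable_continuous_onI continuous_intros)+

lemma subgaussian_all_moments:
  assumes X: "X \<in> borel_measurable pistar" "subgaussian pistar C' X"
  shows "all_moments pistar X"
  unfolding all_moments_def
proof (intro conjI allI X(1))
  fix k :: nat
  have le: "\<bar>x\<bar> ^ k \<le> 1 + x ^ (2 * k)" for x :: real
  proof -
    have "2 * \<bar>x\<bar> ^ k \<le> (\<bar>x\<bar> ^ k)\<^sup>2 + 1" using sum_squares_bound[of "\<bar>x\<bar> ^ k" 1] by simp
    moreover note abs_power_square[of x k]
    moreover have "0 \<le> \<bar>x\<bar> ^ k" by simp
    ultimately show ?thesis by linarith
  qed
  show "integrable pistar (\<lambda>w. \<bar>X w\<bar> ^ k)"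
  proof (rule Bochner_Integration.integrable_bound)
    show "integrable pistar (\<lambda>w. 1 + X w ^ (2 * k))" using subgaussian_even_moment(1)[OF X] by simp
    show "AE w in pistar. norm (\<bar>X w\<bar> ^ k) \<le> norm (1 + X w ^ (2 * k))"
      using order_trans[OF le abs_ge_self] by (intro AE_I2) (simp only: real_norm_def power_abs abs_abs)
  qed (use X(1) in measurable)
qed

sublocale moment_law pistar
proof unfold_locales
  show "sets pistar = sets borel" by (rule sets_pistar')
  show "all_moments pistar fst" by (rule subgaussian_all_moments[OF measurable_coords(1) subgaussian_fst])
  show "all_moments pistar snd" by (rule subgaussian_all_moments[OF measurable_coords(2) subgaussian_snd])
qed

section \<open>Moments of one summand of the linearised overlap\<close>

definition pair_law :: "((real \<times> real) \<times> (real \<times> real)) measure" where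
  "pair_law = pistar \<Otimes>\<^sub>M pistar"

lemma prob_space_pair_law: "prob_space pair_law"
  unfolding pair_law_def by (intro prob_space_pair prob_space_axioms)

lemma finite_measure_pair_law: "finite_measure pair_law"
  by (rule prob_space.finite_measure[OF prob_space_pair_law])

text \<open>The contribution of a single index to the linear combination of the two overlaps;
  \<open>a\<close> and \<open>b\<close> stand for the Gaussian weights together with the scaling by
  \<open>sqrt n\<close>.\<close>

definition increment :: "real \<Rightarrow> real \<Rightarrow> (real \<times> real) \<times> (real \<times> real) \<Rightarrow> real" where
  "increment a b z = a * (fst (fst z) * fst (snd z)) + b * (snd (fst z) * snd (snd z))"

definition moment :: "real \<Rightarrow> real \<Rightarrow> nat \<Rightarrow> real" where
  "moment a b k = (\<integral>z. increment a b z ^ k \<partial>pair_law) / fact k"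

lemmas moments_pair = all_moments_intros finite_measure_pair_law moments_fst moments_snd
    all_moments_fst[OF prob_space_axioms, of pistar, folded pair_law_def]
    all_moments_snd[OF prob_space_axioms prob_space_axioms, folded pair_law_def]

lemma all_moments_increment: "all_moments pair_law (increment a b)"
  unfolding increment_def by (intro moments_pair)

text \<open>The multinomial theorem followed by independence over the index
  \<open>i\<close>.\<close>

lemma integral_replicas_power:
  "(\<integral>z. (\<Sum>i\<in>{1..n}. increment a b (fst z i, snd z i)) ^ p \<partial>replicas n) / fact p =
    (\<Sum>\<kappa>\<in>multi_exps {1..n} p. \<Prod>i\<in>{1..n}. moment a b (\<kappa> i))"
proof -
  let ?X = "\<lambda>i z. increment a b (fst z i, snd z i)"
  have amX: "all_moments (replicas n) (?X i)" if "i \<in> {1..n}" for i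
    unfolding increment_def fst_conv snd_conv
    by (intro all_moments_intros finite_measure_replicas moments_fst moments_snd that all_moments_replicas)
  interpret S: prob_space "sample n" by (rule prob_space_sample)
  interpret SS: pair_prob_space "sample n" "sample n" ..
  interpret PP: pair_prob_space pistar pistar ..
  have one: "(\<integral>z. (\<Prod>i\<in>{1..n}. ?X i z ^ \<kappa> i / fact (\<kappa> i)) \<partial>replicas n) = (\<Prod>i\<in>{1..n}. moment a b (\<kappa> i))" for \<kappa>
  proof -
    let ?\<phi> = "\<lambda>i x y. increment a b (x, y) ^ \<kappa> i / fact (\<kappa> i)"
    have int: "integrable (replicas n) (\<lambda>z. \<Prod>i\<in>{1..n}. ?X i z ^ \<kappa> i / fact (\<kappa> i))"
      by (intro all_moments_integrable all_moments_intros finite_measure_replicas amX)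
    have int_y: "integrable pistar (?\<phi> i x)" for i x
      unfolding increment_def fst_conv snd_conv
      by (intro all_moments_integrable all_moments_intros finite_measure_axioms moments_fst moments_snd)
    have "integrable (pistar \<Otimes>\<^sub>M pistar) (\<lambda>z. increment a b z ^ \<kappa> i / fact (\<kappa> i))" for i
      unfolding pair_law_def[symmetric]
      by (intro all_moments_integrable all_moments_intros finite_measure_pair_law all_moments_increment)
    from PP.integrable_fst'[OF this] PP.integral_fst'[OF this]
    have int_x: "integrable pistar (\<lambda>x. \<integral>y. ?\<phi> i x y \<partial>pistar)"
      and eq_x: "(\<integral>x. (\<integral>y. ?\<phi> i x y \<partial>pistar) \<partial>pistar) = moment a b (\<kappa> i)" for i
      by (simp_all add: moment_def pair_law_def)
    \<comment> \<open>\<open>replicas n\<close> is a pair of product measures rather than a product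
      of pair measures, so the second replica is integrated first with the first one held
      fixed.\<close>
    have inner: "(\<integral>w'. (\<Prod>i\<in>{1..n}. ?\<phi> i (w i) (w' i)) \<partial>sample n) = (\<Prod>i\<in>{1..n}. \<integral>y. ?\<phi> i (w i) y \<partial>pistar)" for w
      unfolding sample_def by (intro integral_PiM_prod prob_space_axioms int_y) simp
    have "(\<integral>z. (\<Prod>i\<in>{1..n}. ?X i z ^ \<kappa> i / fact (\<kappa> i)) \<partial>replicas n)
      = (\<integral>w. (\<integral>w'. (\<Prod>i\<in>{1..n}. ?\<phi> i (w i) (w' i)) \<partial>sample n) \<partial>sample n)"
      using SS.integral_fst'[OF int[unfolded replicas_def]] by (simp add: replicas_def)
    also have "\<dots> = (\<integral>w. (\<Prod>i\<in>{1..n}. \<integral>y. ?\<phi> i (w i) y \<partial>pistar) \<partial>sample n)"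
      by (simp only: inner)
    also have "\<dots> = (\<Prod>i\<in>{1..n}. \<integral>x. (\<integral>y. ?\<phi> i x y \<partial>pistar) \<partial>pistar)"
      unfolding sample_def by (intro integral_PiM_prod prob_space_axioms int_x) simp
    finally show ?thesis by (simp only: eq_x)
  qed
  have "(\<integral>z. (\<Sum>i\<in>{1..n}. ?X i z) ^ p \<partial>replicas n) / fact p
      = (\<integral>z. (\<Sum>\<kappa>\<in>multi_exps {1..n} p. \<Prod>i\<in>{1..n}. ?X i z ^ \<kappa> i / fact (\<kappa> i)) \<partial>replicas n)"
    by (simp add: multinomial_theorem)
  also have "\<dots> = (\<Sum>\<kappa>\<in>multi_exps {1..n} p. \<integral>z. (\<Prod>i\<in>{1..n}. ?X i z ^ \<kappa> i / fact (\<kappa> i)) \<partial>replicas n)"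
    by (intro Bochner_Integration.integral_sum all_moments_integrable all_moments_intros finite_measure_replicas amX)
  finally show ?thesis by (simp only: one)
qed

lemma integral_pair_coords:
  assumes "all_moments pistar f"
  shows "(\<integral>z. f (fst z) * f (snd z) \<partial>pair_law) = (\<integral>x. f x \<partial>pistar)\<^sup>2"
  unfolding pair_law_def power2_eq_square by (intro integral_pair_mult prob_space_axioms assms)

lemma moment_0: "moment a b 0 = 1"
  using prob_space.prob_space[OF prob_space_pair_law] by (simp add: moment_def)

lemma moment_1: "moment a b 1 = 0"
proof -
  have "(\<integral>z. increment a b z \<partial>pair_law) = a * (\<integral>z. fst (fst z) * fst (snd z) \<partial>pair_law) + b * (\<integral>z. snd (fst z) * snd (snd z) \<partial>pair_law)"
  proof -
    have "integrable pair_law (\<lambda>z. fst (fst z) * fst (snd z))" "integrable pair_law (\<lambda>z. snd (fst z) * snd (snd z))"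
      by (intro all_moments_integrable moments_pair)+
    then show ?thesis by (simp add: increment_def)
  qed
  also have "\<dots> = 0"
    using mean_fst mean_snd by (simp add: integral_pair_coords moments_fst moments_snd mean_def)
  finally show ?thesis by (simp add: moment_def)
qed

text \<open>The expectations factorise over the two replicas: the squares contribute 1 each, and the
  mixed term contributes the square of \<open>E (x y) = rho\<close>.\<close>

lemma moment_2: "moment a b 2 = (a\<^sup>2 + b\<^sup>2 + 2 * a * b * rho\<^sup>2) / 2"
proof -
  have am: "all_moments pistar (\<lambda>z. (fst z)\<^sup>2)" "all_moments pistar (\<lambda>z. (snd z)\<^sup>2)" "all_moments pistar (\<lambda>z. fst z * snd z)"
    by (intro all_moments_intros finite_measure_axioms moments_fst moments_snd)+
  have "(\<integral>z. (increment a b z)\<^sup>2 \<partial>pair_law) = (\<integral>z. a\<^sup>2 * ((fst (fst z))\<^sup>2 * (fst (snd z))\<^sup>2) + b\<^sup>2 * ((snd (fst z))\<^sup>2 * (snd (snd z))\<^sup>2)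
      + 2 * a * b * ((fst (fst z) * snd (fst z)) * (fst (snd z) * snd (snd z))) \<partial>pair_law)"
    by (intro Bochner_Integration.integral_cong refl) (simp add: increment_def power2_eq_square algebra_simps)
  also have "\<dots> = a\<^sup>2 * (\<integral>z. (fst (fst z))\<^sup>2 * (fst (snd z))\<^sup>2 \<partial>pair_law) + b\<^sup>2 * (\<integral>z. (snd (fst z))\<^sup>2 * (snd (snd z))\<^sup>2 \<partial>pair_law)
      + 2 * a * b * (\<integral>z. (fst (fst z) * snd (fst z)) * (fst (snd z) * snd (snd z)) \<partial>pair_law)"
  proof -
    have "integrable pair_law (\<lambda>z. (fst (fst z))\<^sup>2 * (fst (snd z))\<^sup>2)" "integrable pair_law (\<lambda>z. (snd (fst z))\<^sup>2 * (snd (snd z))\<^sup>2)"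
      "integrable pair_law (\<lambda>z. (fst (fst z) * snd (fst z)) * (fst (snd z) * snd (snd z)))"
      by (intro all_moments_integrable moments_pair)+
    then show ?thesis by simp
  qed
  also have "\<dots> = a\<^sup>2 + b\<^sup>2 + 2 * a * b * rho\<^sup>2"
    using mean_fst2 mean_snd2 mean_fst_snd
      integral_pair_coords[OF am(1)] integral_pair_coords[OF am(2)] integral_pair_coords[OF am(3)]
    by (simp add: mean_def case_prod_beta')
  finally show ?thesis by (simp add: moment_def)
qed

text \<open>By the inequality of arithmetic and geometric means, the moments of order
  \<open>k\<close> of the products are bounded by moments of order \<open>2 * k\<close> of single
  coordinates. Their growth \<open>fact k\<close> cancels the factorial in \<open>moment\<close>,
  and \<open>k \<ge> 1\<close> lets the remaining factor 2 be absorbed into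
  \<open>2 ^ k\<close>.\<close>

lemma abs_moment_le:
  assumes "k \<ge> 1"
  shows "\<bar>moment a b k\<bar> \<le> (2 * exp (C'\<^sup>2) * (\<bar>a\<bar> + \<bar>b\<bar>)) ^ k"
proof -
  let ?r = "\<bar>a\<bar> + \<bar>b\<bar>"
  let ?B = "\<lambda>z :: (real \<times> real) \<times> (real \<times> real). ?r ^ k * ((fst (fst z) ^ (2 * k) + fst (snd z) ^ (2 * k)) / 2
      + (snd (fst z) ^ (2 * k) + snd (snd z) ^ (2 * k)) / 2)"
  have amgm: "\<bar>x * y\<bar> ^ k \<le> (x ^ (2 * k) + y ^ (2 * k)) / 2" for x y :: real
    using sum_squares_bound[of "\<bar>x\<bar> ^ k" "\<bar>y\<bar> ^ k"]
    by (simp add: abs_mult power_mult_distrib abs_power_square)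
  have le: "\<bar>increment a b z\<bar> ^ k \<le> ?B z" for z
  proof -
    let ?x = "\<bar>fst (fst z) * fst (snd z)\<bar>" and ?y = "\<bar>snd (fst z) * snd (snd z)\<bar>"
    have "\<bar>increment a b z\<bar> \<le> \<bar>a\<bar> * ?x + \<bar>b\<bar> * ?y"
      unfolding increment_def by (metis abs_mult abs_triangle_ineq)
    also have "\<dots> \<le> ?r * max ?x ?y"
      unfolding distrib_right by (intro add_mono mult_left_mono) auto
    finally have "\<bar>increment a b z\<bar> ^ k \<le> (?r * max ?x ?y) ^ k" by (intro power_mono) auto
    also have "\<dots> \<le> ?r ^ k * (?x ^ k + ?y ^ k)"
      unfolding power_mult_distrib by (intro mult_left_mono) (auto simp: max_def)
    also have "\<dots> \<le> ?B z" by (intro mult_left_mono add_mono amgm) auto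
    finally show ?thesis .
  qed
  have pw: "all_moments pistar (\<lambda>z. fst z ^ (2 * k))" "all_moments pistar (\<lambda>z. snd z ^ (2 * k))"
    by (intro all_moments_intros finite_measure_axioms moments_fst moments_snd)+
  have marg: "(\<integral>z. f (fst z) \<partial>pair_law) = (\<integral>x. f x \<partial>pistar)" "(\<integral>z. f (snd z) \<partial>pair_law) = (\<integral>x. f x \<partial>pistar)"
    if "all_moments pistar f" for f
    using integral_pair_mult[OF prob_space_axioms prob_space_axioms that all_moments_const[OF finite_measure_axioms, of 1]]
      integral_pair_mult[OF prob_space_axioms prob_space_axioms all_moments_const[OF finite_measure_axioms, of 1] that]
    by (simp_all add: pair_law_def prob_space)
  have int: "integrable pair_law (\<lambda>z. fst (fst z) ^ (2 * k))" "integrable pair_law (\<lambda>z. fst (snd z) ^ (2 * k))"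
    "integrable pair_law (\<lambda>z. snd (fst z) ^ (2 * k))" "integrable pair_law (\<lambda>z. snd (snd z) ^ (2 * k))"
    by (intro all_moments_integrable moments_pair)+
  have "\<bar>\<integral>z. increment a b z ^ k \<partial>pair_law\<bar> \<le> (\<integral>z. \<bar>increment a b z\<bar> ^ k \<partial>pair_law)"
    using integral_abs_bound[of pair_law "\<lambda>z. increment a b z ^ k"] by (simp add: power_abs)
  also have "\<dots> \<le> (\<integral>z. ?B z \<partial>pair_law)"
  proof (intro integral_mono le all_moments_integrable_abs_power all_moments_increment)
    show "integrable pair_law ?B" using int by simp
  qed
  also have "\<dots> = ?r ^ k * ((\<integral>x. fst x ^ (2 * k) \<partial>pistar) + (\<integral>x. snd x ^ (2 * k) \<partial>pistar))"
    using int marg[OF pw(1)] marg[OF pw(2)] by simp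
  also have "\<dots> \<le> ?r ^ k * (fact k * exp (C'\<^sup>2) ^ k + fact k * exp (C'\<^sup>2) ^ k)"
    by (intro mult_left_mono add_mono subgaussian_even_moment measurable_coords subgaussian_fst subgaussian_snd) auto
  also have "\<dots> = fact k * (2 * (exp (C'\<^sup>2) * ?r) ^ k)"
    by (simp add: power_mult_distrib)
  also have "\<dots> \<le> fact k * (2 ^ k * (exp (C'\<^sup>2) * ?r) ^ k)"
    using self_le_power[of "2::real" k] assms by (intro mult_left_mono mult_right_mono) auto
  finally show ?thesis
    by (simp add: moment_def abs_divide divide_le_eq power_mult_distrib mult_ac)
qed

end

subsection \<open>The Gaussian average\<close>

text \<open>Against the standard normal density the integrand is a multiple of the centred normal
  density of variance \<open>1 / \<delta>\<close>.\<close>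

lemma integrable_std_normal_exp_square:
  assumes "\<delta> > 0"
  shows "integrable std_normal (\<lambda>x. exp ((1 - \<delta>) * x\<^sup>2 / 2))"
proof -
  have "integrable lborel (\<lambda>x. sqrt (1 / \<delta>) * normal_density 0 (sqrt (1 / \<delta>)) x)"
    using assms by (intro integrable_mult_right integrable_normal_density) simp
  moreover have "sqrt (1 / \<delta>) * normal_density 0 (sqrt (1 / \<delta>)) x = std_normal_density x * exp ((1 - \<delta>) * x\<^sup>2 / 2)" for x
    using assms
    by (simp add: normal_density_def real_sqrt_mult real_sqrt_divide exp_add[symmetric] field_simps)
  ultimately show ?thesis by (subst integrable_std_normal_iff) auto
qed

lemma integrable_pair_mult:
  fixes f :: "'a \<Rightarrow> real" and g :: "'b \<Rightarrow> real"
  assumes "prob_space M" "prob_space N" "integrable M f" "integrable N g"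
  shows "integrable (M \<Otimes>\<^sub>M N) (\<lambda>z. f (fst z) * g (snd z))"
proof -
  interpret M: prob_space M by fact
  interpret N: prob_space N by fact
  interpret P: pair_sigma_finite M N ..
  have [measurable]: "f \<in> borel_measurable M" "g \<in> borel_measurable N" using assms by auto
  show ?thesis
    by (rule P.Fubini_integrable) (use assms in \<open>auto simp: abs_mult\<close>)
qed

text \<open>Dominates the series of linearised moments for all large \<open>n\<close>. The last
  summand is half the variance of the Gaussian-weighted sum, \<open>1\<close> pays for all moments
  of order at least 3, and the absolute values come from trading \<open>r\<close> for
  \<open>exp r\<close>.\<close>

definition tilt :: "real \<Rightarrow> real \<Rightarrow> real \<Rightarrow> real \<times> real \<Rightarrow> real" where
  "tilt lam mu rho \<gamma> = exp (1 + (\<bar>fst \<gamma>\<bar> + \<bar>snd \<gamma>\<bar>) +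
     (lam\<^sup>2 * (fst \<gamma>)\<^sup>2 + mu\<^sup>2 * (snd \<gamma>)\<^sup>2 + 2 * lam * mu * fst \<gamma> * snd \<gamma> * rho\<^sup>2) / 2)"

text \<open>Clearing denominators in the third component of \<open>F\<close>, the mixed terms cancel
  and \<open>u * v < A * B\<close> remains. This is the determinant condition for positive
  definiteness of the quadratic form.\<close>

lemma F_lt_1:
  assumes "F lam mu rho 1 < 1" "0 < rho"
  shows "lam\<^sup>2 < 1" "mu\<^sup>2 < 1" "(lam * mu * rho\<^sup>2)\<^sup>2 < (1 - lam\<^sup>2) * (1 - mu\<^sup>2)"
proof -
  have all: "lam\<^sup>2 < 1 \<and> mu\<^sup>2 < 1 \<and>
      lam\<^sup>2 * rho\<^sup>2 / (1 - lam\<^sup>2 + lam\<^sup>2 * rho\<^sup>2) + mu\<^sup>2 * rho\<^sup>2 / (1 - mu\<^sup>2 + mu\<^sup>2 * rho\<^sup>2) < 1"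
    using assms(1) unfolding F_def by (subst (asm) Max_less_iff) auto
  then show "lam\<^sup>2 < 1" "mu\<^sup>2 < 1" by auto
  define A B u v where "A = 1 - lam\<^sup>2" and "B = 1 - mu\<^sup>2" and "u = lam\<^sup>2 * rho\<^sup>2" and "v = mu\<^sup>2 * rho\<^sup>2"
  have pos: "A > 0" "B > 0" "u \<ge> 0" "v \<ge> 0" using all by (auto simp: A_def B_def u_def v_def)
  have "u / (A + u) + v / (B + v) < 1" using all by (simp add: A_def B_def u_def v_def)
  then have "u * (B + v) + v * (A + u) < (A + u) * (B + v)"
    using pos by (simp add: add_frac_eq divide_less_eq add_pos_nonneg)
  then have "u * v < A * B" by (simp add: algebra_simps)
  then show "(lam * mu * rho\<^sup>2)\<^sup>2 < (1 - lam\<^sup>2) * (1 - mu\<^sup>2)"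
    by (simp add: A_def B_def u_def v_def power2_eq_square mult_ac)
qed

text \<open>\<open>\<delta>\<close> is the determinant of the form divided by its trace, which is a
  lower bound for the smaller eigenvalue.\<close>

lemma positive_definite_form:
  fixes A B c x y :: real
  assumes "A > 0" "B > 0" "c\<^sup>2 < A * B"
  defines "\<delta> \<equiv> (A * B - c\<^sup>2) / (A + B)"
  shows "\<delta> > 0" "\<delta> * (x\<^sup>2 + y\<^sup>2) \<le> A * x\<^sup>2 + B * y\<^sup>2 - 2 * c * x * y"
proof -
  show "\<delta> > 0" using assms by (simp add: \<delta>_def)
  have s: "\<delta> * (A + B) = A * B - c\<^sup>2" using assms by (simp add: \<delta>_def)
  have A: "A - \<delta> > 0"
  proof -
    have "(A - \<delta>) * (A + B) = A\<^sup>2 + c\<^sup>2" using s by (simp add: algebra_simps power2_eq_square)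
    also have "\<dots> > 0" using assms by (simp add: add_pos_nonneg)
    finally show ?thesis using assms by (simp add: zero_less_mult_iff)
  qed
  \<comment> \<open>Completing the square in \<open>x\<close>; by the choice of
    \<open>\<delta>\<close> the coefficient left over for \<open>y\<^sup>2\<close> is
    \<open>\<delta>\<^sup>2\<close>.\<close>
  have "(A - \<delta>) * (A * x\<^sup>2 + B * y\<^sup>2 - 2 * c * x * y - \<delta> * (x\<^sup>2 + y\<^sup>2))
      = ((A - \<delta>) * x - c * y)\<^sup>2 + (A * B - \<delta> * (A + B) + \<delta>\<^sup>2 - c\<^sup>2) * y\<^sup>2"
    by (simp add: algebra_simps power2_eq_square)
  also have "\<dots> \<ge> 0" unfolding s by simp
  finally show "\<delta> * (x\<^sup>2 + y\<^sup>2) \<le> A * x\<^sup>2 + B * y\<^sup>2 - 2 * c * x * y"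
    using A by (simp add: zero_le_mult_iff)
qed

lemma integrable_tilt:
  assumes "lam\<^sup>2 < 1" "mu\<^sup>2 < 1" "(lam * mu * rho\<^sup>2)\<^sup>2 < (1 - lam\<^sup>2) * (1 - mu\<^sup>2)"
  shows "integrable (std_normal \<Otimes>\<^sub>M std_normal) (tilt lam mu rho)"
proof -
  define \<delta> where "\<delta> = ((1 - lam\<^sup>2) * (1 - mu\<^sup>2) - (lam * mu * rho\<^sup>2)\<^sup>2) / (1 - lam\<^sup>2 + (1 - mu\<^sup>2))"
  have \<delta>: "\<delta> > 0"
    and form: "\<delta> * (x\<^sup>2 + y\<^sup>2) \<le> (1 - lam\<^sup>2) * x\<^sup>2 + (1 - mu\<^sup>2) * y\<^sup>2 - 2 * (lam * mu * rho\<^sup>2) * x * y" for x y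
    unfolding \<delta>_def using assms by (intro positive_definite_form; simp)+
  \<comment> \<open>Half of the gap \<open>\<delta>\<close> is spent on the linear terms, so the
    Gaussian exponents below retain the margin \<open>\<delta> / 2\<close>.\<close>
  have lin: "\<bar>x\<bar> \<le> 1 / \<delta> + \<delta> * x\<^sup>2 / 4" for x
  proof -
    have "0 \<le> (\<delta> * \<bar>x\<bar> / 2 - 1)\<^sup>2 / \<delta>" using \<delta> by simp
    also have "\<dots> = \<delta> * x\<^sup>2 / 4 - \<bar>x\<bar> + 1 / \<delta>"
      using \<delta> by (simp add: power2_diff power_mult_distrib power_divide field_simps power2_eq_square)
    finally show ?thesis by simp
  qed
  let ?e = "\<lambda>x::real. exp ((1 - \<delta> / 2) * x\<^sup>2 / 2)"
  have le: "tilt lam mu rho \<gamma> \<le> exp (1 + 2 / \<delta>) * (?e (fst \<gamma>) * ?e (snd \<gamma>))" for \<gamma>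
  proof -
    have "1 + (\<bar>fst \<gamma>\<bar> + \<bar>snd \<gamma>\<bar>) + (lam\<^sup>2 * (fst \<gamma>)\<^sup>2 + mu\<^sup>2 * (snd \<gamma>)\<^sup>2 + 2 * lam * mu * fst \<gamma> * snd \<gamma> * rho\<^sup>2) / 2
      \<le> 1 + 2 / \<delta> + ((1 - \<delta> / 2) * (fst \<gamma>)\<^sup>2 / 2 + (1 - \<delta> / 2) * (snd \<gamma>)\<^sup>2 / 2)"
      using form[of "fst \<gamma>" "snd \<gamma>"] lin[of "fst \<gamma>"] lin[of "snd \<gamma>"] by (simp add: field_simps)
    then show ?thesis by (simp add: tilt_def flip: exp_add)
  qed
  show ?thesis
  proof (rule Bochner_Integration.integrable_bound)
    show "integrable (std_normal \<Otimes>\<^sub>M std_normal) (\<lambda>\<gamma>. exp (1 + 2 / \<delta>) * (?e (fst \<gamma>) * ?e (snd \<gamma>)))"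
      using \<delta> by (intro integrable_mult_right integrable_pair_mult integrable_std_normal_exp_square prob_space_std_normal) auto
    show "tilt lam mu rho \<in> borel_measurable (std_normal \<Otimes>\<^sub>M std_normal)"
      unfolding tilt_def by measurable
    show "AE \<gamma> in std_normal \<Otimes>\<^sub>M std_normal. norm (tilt lam mu rho \<gamma>) \<le> norm (exp (1 + 2 / \<delta>) * (?e (fst \<gamma>) * ?e (snd \<gamma>)))"
      using le by (intro AE_I2) (simp add: tilt_def abs_mult)
  qed
qed

section \<open>Uniform second-moment bound for degrees of subpolynomial growth\<close>

lemma eventually_degree_small:
  assumes "n_pow_o1 D" "K > 0"
  shows "\<forall>\<^sub>F n in sequentially. n > 0 \<and> real (2 * D n) * (K / sqrt (real n)) \<le> 1 / 2 \<and>
    real n * (2 * (real (2 * D n) * (K / sqrt (real n))) ^ 3) \<le> 1"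
proof -
  obtain e where e: "e \<longlonglongrightarrow> 0" and D: "\<forall>\<^sub>F n in sequentially. real (D n) \<le> real n powr e n"
    using assms(1) unfolding n_pow_o1_def by blast
  \<comment> \<open>With \<open>D n\<close> at most \<open>n\<close> to the power
    \<open>1/12\<close>, \<open>b\<close> has order \<open>n\<close> to the power
    \<open>-5/12\<close>, so \<open>n\<close> times its cube has order \<open>n\<close> to the power
    \<open>-1/4\<close>. Any exponent strictly between 0 and \<open>1/6\<close> would serve.\<close>
  define b where "b = (\<lambda>n::nat. 2 * real n powr (1 / 12) * (K / sqrt (real n)))"
  have "\<forall>\<^sub>F n in sequentially. e n < 1 / 12" using e by (rule order_tendstoD) simp
  moreover have "b \<longlonglongrightarrow> 0" unfolding b_def using assms(2) by real_asymp
  then have "\<forall>\<^sub>F n in sequentially. b n < 1 / 2" by (rule order_tendstoD) simp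
  moreover have "(\<lambda>n. real n * (2 * b n ^ 3)) \<longlonglongrightarrow> 0" unfolding b_def using assms(2) by real_asymp
  then have "\<forall>\<^sub>F n in sequentially. real n * (2 * b n ^ 3) < 1" by (rule order_tendstoD) simp
  ultimately show ?thesis
    using D eventually_gt_at_top[of 0]
  proof eventually_elim
    case (elim n)
    have "real (D n) \<le> real n powr (1 / 12)"
      using elim by (intro order_trans[OF elim(4)] powr_mono) auto
    then have le: "real (2 * D n) * (K / sqrt (real n)) \<le> b n"
      unfolding b_def using assms(2) by (intro mult_right_mono) auto
    have "real n * (2 * (real (2 * D n) * (K / sqrt (real n))) ^ 3) \<le> real n * (2 * b n ^ 3)"
      using assms(2) by (intro mult_left_mono power_mono le) auto
    then show ?case using elim le by linarith
  qed
qed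

context correlated_subgaussian_law
begin

text \<open>For fixed Gaussian weights this is a sum of \<open>n\<close> independent centred
  increments of size of order \<open>1 / sqrt n\<close>. The bound for such sums applies with
  \<open>M = 2 * D\<close>, and \<open>n * \<tau>\<close> does not depend on
  \<open>n\<close>.\<close>

lemma linear_moments_le_tilt:
  assumes n: "n > 0" and lam: "0 \<le> lam" "lam \<le> 1" and mu: "0 \<le> mu" "mu \<le> 1"
    and small: "real (2 * D) * (2 * exp (C'\<^sup>2) / sqrt (real n)) \<le> 1 / 2"
      "real n * (2 * (real (2 * D) * (2 * exp (C'\<^sup>2) / sqrt (real n))) ^ 3) \<le> 1"
  shows "(\<Sum>d\<le>D. (\<integral>z. (lam * fst \<gamma> * overlap n fst z + mu * snd \<gamma> * overlap n snd z) ^ (2 * d) \<partial>replicas n) / fact (2 * d))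
    \<le> tilt lam mu rho \<gamma>"
proof -
  define a b where "a = lam * fst \<gamma> / sqrt (real n)" and "b = mu * snd \<gamma> / sqrt (real n)"
  define r \<theta> where "r = \<bar>fst \<gamma>\<bar> + \<bar>snd \<gamma>\<bar>" and "\<theta> = 2 * exp (C'\<^sup>2) / sqrt (real n)"
  define \<tau> where "\<tau> = (a\<^sup>2 + b\<^sup>2 + 2 * a * b * rho\<^sup>2) / 2"
  define T where "T = (\<lambda>p. \<Sum>\<kappa>\<in>multi_exps {1..n} p. \<Prod>i\<in>{1..n}. moment a b (\<kappa> i))"
  have lin: "lam * fst \<gamma> * overlap n fst z + mu * snd \<gamma> * overlap n snd z = (\<Sum>i\<in>{1..n}. increment a b (fst z i, snd z i))" for z
    by (simp add: overlap_def increment_def a_def b_def sum.distrib sum_distrib_left sum_divide_distrib)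
  have r: "\<bar>a\<bar> + \<bar>b\<bar> \<le> r / sqrt (real n)"
    using lam mu n unfolding a_def b_def r_def
    by (auto simp: abs_mult abs_divide add_divide_distrib intro!: add_mono divide_right_mono mult_left_le_one_le)
  have tail: "\<bar>moment a b k\<bar> \<le> (\<theta> * r) ^ k" if "k \<ge> 3" for k
  proof -
    have "2 * exp (C'\<^sup>2) * (\<bar>a\<bar> + \<bar>b\<bar>) \<le> \<theta> * r"
      using mult_left_mono[OF r, of "2 * exp (C'\<^sup>2)"] by (simp add: \<theta>_def)
    then show ?thesis using that
      by (intro order_trans[OF abs_moment_le power_mono]) auto
  qed
  have "\<tau> \<ge> 0"
  proof -
    \<comment> \<open>Nonnegativity is seen from the meaning of \<open>\<tau>\<close> as half a
      second moment.\<close>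
    have "\<tau> = moment a b 2" by (simp add: \<tau>_def moment_2)
    also have "\<dots> \<ge> 0" unfolding moment_def by (intro divide_nonneg_pos Bochner_Integration.integral_nonneg) auto
    finally show ?thesis .
  qed
  have "(\<Sum>d\<le>D. (\<integral>z. (lam * fst \<gamma> * overlap n fst z + mu * snd \<gamma> * overlap n snd z) ^ (2 * d) \<partial>replicas n) / fact (2 * d))
      = (\<Sum>d\<le>D. T (2 * d))"
    unfolding lin T_def by (intro sum.cong refl integral_replicas_power)
  also have "\<dots> \<le> (\<Sum>d\<le>D. \<bar>T (2 * d)\<bar>)" by (intro sum_mono) simp
  also have "\<dots> = (\<Sum>p\<in>(\<lambda>d. 2 * d) ` {..D}. \<bar>T p\<bar>)" by (subst sum.reindex) (auto simp: inj_on_def)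
  \<comment> \<open>Filling in the odd degrees adds only nonnegative terms and gives the range of
    summation that the moment bound expects.\<close>
  also have "\<dots> \<le> (\<Sum>p\<le>2 * D. \<bar>T p\<bar>)" by (intro sum_mono2) auto
  also have "\<dots> \<le> exp (r + real (card {1..n}) * (\<tau> + 2 * (real (2 * D) * \<theta>) ^ 3))"
    unfolding T_def
  proof (rule sum_multi_exps_moments_le)
    show "moment a b 2 = \<tau>" by (simp add: \<tau>_def moment_2)
    show "real (2 * D) * \<theta> \<le> 1 / 2" using small(1) by (simp only: \<theta>_def)
  qed (use \<open>\<tau> \<ge> 0\<close> tail in \<open>auto simp: moment_0 moment_1[simplified] r_def \<theta>_def\<close>)
  also have "\<dots> \<le> tilt lam mu rho \<gamma>"
  proof -
    have n\<tau>: "real n * \<tau> = (lam\<^sup>2 * (fst \<gamma>)\<^sup>2 + mu\<^sup>2 * (snd \<gamma>)\<^sup>2 + 2 * lam * mu * fst \<gamma> * snd \<gamma> * rho\<^sup>2) / 2"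
      using n by (simp add: \<tau>_def a_def b_def power2_eq_square field_simps)
    have "real (card {1..n}) * (\<tau> + 2 * (real (2 * D) * \<theta>) ^ 3) = real n * \<tau> + real n * (2 * (real (2 * D) * \<theta>) ^ 3)"
      by (simp add: distrib_left)
    also have "\<dots> \<le> (lam\<^sup>2 * (fst \<gamma>)\<^sup>2 + mu\<^sup>2 * (snd \<gamma>)\<^sup>2 + 2 * lam * mu * fst \<gamma> * snd \<gamma> * rho\<^sup>2) / 2 + 1"
      by (rule add_mono[OF eq_refl[OF n\<tau>] small(2)[folded \<theta>_def]])
    finally show ?thesis
      unfolding tilt_def r_def[symmetric] exp_le_cancel_iff by linarith
  qed
  finally show ?thesis .
qed

text \<open>Stated for every \<open>g\<close> in the Hermite span, so that it serves a polynomial as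
  well as its centred version. In the final comparison of integrals only the majorant
  \<open>tilt\<close> has to be integrable.\<close>

lemma mean_hatP_square_le_tilt:
  assumes n: "n > 0" and lam: "0 \<le> lam" "lam \<le> 1" and mu: "0 \<le> mu" "mu \<le> 1"
    and small: "real (2 * D) * (2 * exp (C'\<^sup>2) / sqrt (real n)) \<le> 1 / 2"
      "real n * (2 * (real (2 * D) * (2 * exp (C'\<^sup>2) / sqrt (real n))) ^ 3) \<le> 1"
    and int: "integrable (std_normal \<Otimes>\<^sub>M std_normal) (tilt lam mu rho)"
    and g: "lincomb (exps_le n D) (herm_prod n) g"
  shows "(mean (hatP lam mu pistar n) g)\<^sup>2 \<le>
    mean (hatQ n) (\<lambda>XY. (g XY)\<^sup>2) * mean (std_normal \<Otimes>\<^sub>M std_normal) (tilt lam mu rho)"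
proof -
  have nonneg: "0 \<le> mean (hatQ n) (\<lambda>XY. (g XY)\<^sup>2)"
    unfolding mean_def by (intro Bochner_Integration.integral_nonneg) auto
  show ?thesis
    by (rule order_trans[OF mean_hatP_square_le[OF g] mult_left_mono[OF _ nonneg]],
        unfold sum_signal_moments integral_overlap_linearised mean_def,
        rule integral_mono_AE'[OF int])
      (use linear_moments_le_tilt[OF n lam mu small] in \<open>auto simp: tilt_def\<close>)
qed

end

section \<open>Boundedness of the advantage and failure of strong separation\<close>

lemma lincomb_const: "lincomb (exps_le n D) (herm_prod n) (\<lambda>XY. c)"
proof -
  let ?z = "restrict (\<lambda>_. 0) (vars n)"
  have "herm_prod n ?z = (\<lambda>XY. 1)" by (rule ext) (simp add: herm_prod_def)
  moreover have "?z \<in> exps_le n D" by (auto simp: exps_le_def multi_exps_def)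
  ultimately have "lincomb (exps_le n D) (herm_prod n) (\<lambda>XY. 1)"
    using lincomb_base[OF finite_exps_le] by metis
  from lincomb_scale[OF this, of c] show ?thesis by simp
qed

lemma not_strongly_separates:
  assumes gap: "\<forall>\<^sub>F n in sequentially.
      (mean (P n) (poly_eval (f n)) - mean (Q n) (poly_eval (f n)))\<^sup>2 \<le> C0 * var (Q n) (poly_eval (f n))"
    and C0: "C0 \<ge> 0"
  shows "\<not> strongly_separates f P Q"
proof
  let ?gap = "\<lambda>n. mean (P n) (poly_eval (f n)) - mean (Q n) (poly_eval (f n))"
  let ?v = "\<lambda>n. max (var (P n) (poly_eval (f n))) (var (Q n) (poly_eval (f n)))"
  assume s: "strongly_separates f P Q"
  \<comment> \<open>Any positive \<open>c\<close> with \<open>c * sqrt C0 < 1\<close> works: for a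
    nonzero gap the little-o bound and the variance bound combine to make the gap strictly smaller
    than itself.\<close>
  define c where "c = 1 / (sqrt C0 + 1)"
  have c: "c > 0" "c * sqrt C0 < 1" using C0 by (auto simp: c_def add_nonneg_pos divide_less_eq)
  have "\<forall>\<^sub>F n in sequentially. norm (sqrt (?v n)) \<le> c * norm \<bar>?gap n\<bar>"
    using s c(1) unfolding strongly_separates_def by (auto dest: landau_o.smallD)
  moreover have "\<forall>\<^sub>F n in sequentially. ?gap n \<noteq> 0"
    using s unfolding strongly_separates_def by (auto elim: eventually_mono)
  ultimately have "\<forall>\<^sub>F n in sequentially. False"
    using gap
  proof eventually_elim
    case (elim n)
    have "\<bar>?gap n\<bar> \<le> sqrt (C0 * var (Q n) (poly_eval (f n)))"
      using elim(3) by (metis real_sqrt_abs real_sqrt_le_mono)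
    also have "\<dots> \<le> sqrt C0 * sqrt (?v n)"
      using C0 by (simp add: real_sqrt_mult mult_left_mono)
    also have "\<dots> \<le> sqrt C0 * (c * \<bar>?gap n\<bar>)"
      using elim(1) C0 by (intro mult_left_mono) (auto intro: order_trans[OF abs_ge_self])
    also have "\<dots> = (c * sqrt C0) * \<bar>?gap n\<bar>" by simp
    also have "\<dots> < 1 * \<bar>?gap n\<bar>" using c(2) elim(2) by (intro mult_strict_right_mono) auto
    finally show False by simp
  qed
  then show False by simp
qed

theorem theorem5p4:
  fixes lam mu rho eps :: real
  assumes "lam \<ge> 0" and "mu \<ge> 0" and "0 < rho" and "rho < 1"
    and "eps > 0" and "F lam mu rho 1 < 1 - eps"
  shows "\<exists>C :: real. \<forall>(pistar :: (real \<times> real) measure) (C' :: real) (D :: nat \<Rightarrow> nat).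
     prob_space pistar \<longrightarrow> sets pistar = sets borel \<longrightarrow>
     mean pistar fst = 0 \<longrightarrow> mean pistar snd = 0 \<longrightarrow>
     mean pistar (\<lambda>(x, y). x\<^sup>2) = 1 \<longrightarrow> mean pistar (\<lambda>(x, y). y\<^sup>2) = 1 \<longrightarrow>
     mean pistar (\<lambda>(x, y). x * y) = rho \<longrightarrow>
     subgaussian pistar C' fst \<longrightarrow> subgaussian pistar C' snd \<longrightarrow>
     (\<forall>a b :: nat. (mean pistar (\<lambda>(x, y). x ^ a * y ^ b))\<^sup>2
        \<ge> (mean pistar (\<lambda>(x, y). x ^ a))\<^sup>2 * (mean pistar (\<lambda>(x, y). y ^ b))\<^sup>2) \<longrightarrow>
     n_pow_o1 D \<longrightarrow>
       (\<forall>\<^sub>F n in sequentially. chi2_le n (D n) (hatP lam mu pistar n) (hatQ n) \<le> ereal C) \<and>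
       (\<forall>f :: nat \<Rightarrow> mat_poly. (\<forall>n. f n \<in> polys_le n (D n)) \<longrightarrow>
          \<not> strongly_separates f (hatP lam mu pistar) hatQ)"
proof (intro exI allI impI)
  \<comment> \<open>The witness is \<open>sqrt C0\<close>, which depends on \<open>lam\<close>,
    \<open>mu\<close> and \<open>rho\<close> alone. The law, \<open>C'\<close> and \<open>D\<close>
    only influence from which \<open>n\<close> on the bound holds.\<close>
  define C0 where "C0 = mean (std_normal \<Otimes>\<^sub>M std_normal) (tilt lam mu rho)"
  fix pistar :: "(real \<times> real) measure" and C' :: real and D :: "nat \<Rightarrow> nat"
  assume H: "prob_space pistar" "sets pistar = sets borel" "mean pistar fst = 0" "mean pistar snd = 0"
    "mean pistar (\<lambda>(x, y). x\<^sup>2) = 1" "mean pistar (\<lambda>(x, y). y\<^sup>2) = 1" "mean pistar (\<lambda>(x, y). x * y) = rho"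
    "subgaussian pistar C' fst" "subgaussian pistar C' snd"
  assume D: "n_pow_o1 D"
  interpret correlated_subgaussian_law pistar rho C'
    by (intro correlated_subgaussian_law.intro correlated_subgaussian_law_axioms.intro H)
  have "F lam mu rho 1 < 1" using assms by linarith
  note F = F_lt_1[OF this \<open>0 < rho\<close>]
  have lam: "lam \<le> 1" and mu: "mu \<le> 1"
    using F(1,2) assms(1,2) by (auto simp: power2_less_1_iff abs_if split: if_splits)
  have C0: "C0 \<ge> 0" unfolding C0_def mean_def by (intro Bochner_Integration.integral_nonneg) (simp add: tilt_def)
  have K: "2 * exp (C'\<^sup>2) > 0" by simp
  have main: "\<forall>\<^sub>F n in sequentially. \<forall>g. lincomb (exps_le n (D n)) (herm_prod n) g \<longrightarrow>
      (mean (hatP lam mu pistar n) g)\<^sup>2 \<le> mean (hatQ n) (\<lambda>XY. (g XY)\<^sup>2) * C0"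
    using eventually_degree_small[OF D K]
  proof eventually_elim
    case (elim n)
    then show ?case
      unfolding C0_def using assms(1,2) lam mu integrable_tilt[OF F] by (auto intro!: mean_hatP_square_le_tilt)
  qed
  have "\<forall>\<^sub>F n in sequentially. chi2_le n (D n) (hatP lam mu pistar n) (hatQ n) \<le> ereal (sqrt C0)"
    using main
  proof eventually_elim
    case (elim n)
    show ?case unfolding chi2_le_def
    proof (rule SUP_least)
      fix f assume "f \<in> polys_le n (D n) - {0}"
      then have "(mean (hatP lam mu pistar n) (poly_eval f))\<^sup>2 \<le> mean (hatQ n) (\<lambda>XY. (poly_eval f XY)\<^sup>2) * C0"
        using elim lincomb_poly_eval by blast
      then have "\<bar>mean (hatP lam mu pistar n) (poly_eval f)\<bar> \<le> sqrt (mean (hatQ n) (\<lambda>XY. (poly_eval f XY)\<^sup>2)) * sqrt C0"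
        by (metis real_sqrt_abs real_sqrt_le_mono real_sqrt_mult)
      moreover have "0 \<le> sqrt (mean (hatQ n) (\<lambda>XY. (poly_eval f XY)\<^sup>2))"
        unfolding mean_def by simp
      \<comment> \<open>If the denominator is 0, the ratio is 0 by the convention for division,
        which is at most \<open>sqrt C0\<close>.\<close>
      ultimately show "ereal (mean (hatP lam mu pistar n) (poly_eval f) / sqrt (mean (hatQ n) (\<lambda>XY. (poly_eval f XY)\<^sup>2)))
          \<le> ereal (sqrt C0)"
        using C0 by (cases "sqrt (mean (hatQ n) (\<lambda>XY. (poly_eval f XY)\<^sup>2)) = 0")
          (auto simp: divide_le_eq mult.commute)
    qed
  qed
  moreover have "\<not> strongly_separates f (hatP lam mu pistar) hatQ" if f: "\<forall>n. f n \<in> polys_le n (D n)" for f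
  proof (rule not_strongly_separates[OF _ C0])
    show "\<forall>\<^sub>F n in sequentially. (mean (hatP lam mu pistar n) (poly_eval (f n)) - mean (hatQ n) (poly_eval (f n)))\<^sup>2
        \<le> C0 * var (hatQ n) (poly_eval (f n))"
      using main
    proof eventually_elim
      case (elim n)
      let ?p = "poly_eval (f n)" and ?m = "mean (hatQ n) (poly_eval (f n))"
      have lc: "lincomb (exps_le n (D n)) (herm_prod n) ?p" using f by (intro lincomb_poly_eval) blast
      \<comment> \<open>The main bound is applied to the polynomial centred under
        \<open>hatQ\<close>: its second moment there is the variance, and its mean under
        \<open>hatP\<close> is the gap of the two means.\<close>
      have lc': "lincomb (exps_le n (D n)) (herm_prod n) (\<lambda>XY. ?p XY - ?m)"
        using lincomb_add[OF lc lincomb_const[of _ _ "- ?m"]] by simp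
      have "mean (hatP lam mu pistar n) (\<lambda>XY. ?p XY - ?m) = mean (hatP lam mu pistar n) ?p - ?m"
      proof -
        interpret P: prob_space "hatP lam mu pistar n" by (rule prob_space_hatP)
        show ?thesis unfolding mean_def
          using all_moments_integrable[OF all_moments_lincomb_hatP[OF lc]] by (simp add: P.prob_space)
      qed
      then show ?case using elim lc' by (auto simp: var_def mult.commute)
    qed
  qed
  ultimately show "(\<forall>\<^sub>F n in sequentially. chi2_le n (D n) (hatP lam mu pistar n) (hatQ n) \<le> ereal (sqrt C0)) \<and>
       (\<forall>f :: nat \<Rightarrow> mat_poly. (\<forall>n. f n \<in> polys_le n (D n)) \<longrightarrow>
          \<not> strongly_separates f (hatP lam mu pistar) hatQ)" by blast
qed

end
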